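(* Let $X_1,\ldots,X_n$ be Banach spaces, let $r\in\mathbb{N}$ ($r\ge 1$), and let $\alpha$ and $\beta$ be reasonable cross norms on $X_1\otimes\cdots\otimes X_n$. Then the metric spaces $(\mathcal{S}^r_{X_1,\ldots,X_n},d_\alpha)$ and $(\mathcal{S}^r_{X_1,\ldots,X_n},d_\beta)$ are Lipschitz equivalent via the identity map. In fact, for every $w,z\in\mathcal{S}^r_{X_1,\ldots,X_n}$, $$d_\alpha(w,z)\le (2r)^{n-1}\,d_\beta(w,z)\qquad\text{and}\qquad \|z\|_\alpha\le r^{n-1}\|z\|_\beta .$$
   Context: All Banach spaces are over the same field $\mathbb{K}=\mathbb{R}$ or $\mathbb{C}$; $X_1\otimes\cdots\otimes X_n$ is the algebraic tensor product. A norm $\alpha$ on $X_1\otimes\cdots\otimes X_n$ is a reasonable cross norm if (1) $\alpha(x_1\otimes\cdots\otimes x_n)\le\|x_1\|\cdots\|x_n\|$ for all $x_i\in X_i$, and (2) for all $x_i^*\in X_i^*$ the linear functional $x_1^*\otimes\cdots\otimes x_n^*$ on $(X_1\otimes\cdots\otimes X_n,\alpha)$ is bounded with norm at most $\|x_1^*\|\cdots\|x_n^*\|$. The rank $r_z$ of $z\in X_1\otimes\cdots\otimes X_n$ is the least $r$ such that $z=\sum_{i=1}^r x_1^i\otimes\cdots\otimes x_n^i$ with $x_j^i\in X_j$. $\mathcal{S}^r_{X_1,\ldots,X_n}=\{z\in X_1\otimes\cdots\otimes X_n: r_z\le r\}$. $\|z\|_\alpha=\alpha(z)$, and $d_\alpha(w,z)=\|w-z\|_\alpha$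 is the metric induced on $\mathcal{S}^r_{X_1,\ldots,X_n}$ (similarly for $\beta$). *)

theory Defs
  imports "HOL-Analysis.Analysis" "HOL-Algebra.Module"
begin

section \<open>Normed spaces and Banach spaces with explicit carriers\<close>

text \<open>
  The theorem is about a family of Banach spaces whose length is a variable, so the spaces are
  carrier-based modules in the sense of HOL-Algebra rather than types. The scalar field \<open>K\<close> is a
  set of complex numbers, \<open>K = \<real>\<close> or \<open>K = UNIV\<close>. The record \<open>scalars K\<close> serves both as the ring
  of scalars and as the one-dimensional space over it.
\<close>

definition scalars :: "complex set \<Rightarrow> (complex, complex) module" where
  "scalars K = \<lparr>carrier = K, mult = (*), one = 1, zero = 0, add = (+), smult = (*)\<rparr>"

locale normed_space = module "scalars K" V
  for K :: "complex set" and V :: "(complex, 'a) module" (structure) +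
  fixes N :: "'a \<Rightarrow> real"
  assumes norm_nonneg: "x \<in> carrier V \<Longrightarrow> 0 \<le> N x"
    and norm_eq_0_iff: "x \<in> carrier V \<Longrightarrow> N x = 0 \<longleftrightarrow> x = \<zero>"
    and norm_smult: "c \<in> K \<Longrightarrow> x \<in> carrier V \<Longrightarrow> N (c \<odot> x) = cmod c * N x"
    and norm_triangle: "x \<in> carrier V \<Longrightarrow> y \<in> carrier V \<Longrightarrow> N (x \<oplus> y) \<le> N x + N y"

text \<open>
  The value \<open>0\<close> off the carrier is there because \<^locale>\<open>Metric_space\<close> requires nonnegativity and
  symmetry on the whole type.
\<close>

definition norm_dist :: "(complex, 'a) module \<Rightarrow> ('a \<Rightarrow> real) \<Rightarrow> 'a \<Rightarrow> 'a \<Rightarrow> real" where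
  "norm_dist V N x y =
     (if x \<in> carrier V \<and> y \<in> carrier V then N (x \<ominus>\<^bsub>V\<^esub> y) else 0)"

locale banach_space = normed_space +
  assumes complete: "Metric_space.mcomplete (carrier V) (norm_dist V N)"

definition linear_map ::
  "complex set \<Rightarrow> (complex, 'a) module \<Rightarrow> (complex, 'b) module \<Rightarrow> ('a \<Rightarrow> 'b) \<Rightarrow> bool" where
  "linear_map K V W f \<longleftrightarrow>
     f \<in> carrier V \<rightarrow> carrier W \<and>
     (\<forall>x\<in>carrier V. \<forall>y\<in>carrier V. f (x \<oplus>\<^bsub>V\<^esub> y) = f x \<oplus>\<^bsub>W\<^esub> f y) \<and>
     (\<forall>c\<in>K. \<forall>x\<in>carrier V. f (c \<odot>\<^bsub>V\<^esub> x) = c \<odot>\<^bsub>W\<^esub> f x)"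

definition bounded_functional ::
  "complex set \<Rightarrow> (complex, 'a) module \<Rightarrow> ('a \<Rightarrow> real) \<Rightarrow> ('a \<Rightarrow> complex) \<Rightarrow> bool" where
  "bounded_functional K V N f \<longleftrightarrow>
     linear_map K V (scalars K) f \<and> (\<exists>B. \<forall>x\<in>carrier V. cmod (f x) \<le> B * N x)"

definition functional_norm ::
  "(complex, 'a) module \<Rightarrow> ('a \<Rightarrow> real) \<Rightarrow> ('a \<Rightarrow> complex) \<Rightarrow> real" where
  "functional_norm V N f = (SUP x\<in>{x \<in> carrier V. N x \<le> 1}. cmod (f x))"


section \<open>The algebraic tensor product\<close>

definition tuples :: "nat \<Rightarrow> (nat \<Rightarrow> (complex, 'a) module) \<Rightarrow> (nat \<Rightarrow> 'a) set" where
  "tuples n X = (\<Pi>\<^sub>E i\<in>{1..n}. carrier (X i))"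

definition multilinear_map :: "complex set \<Rightarrow> nat \<Rightarrow> (nat \<Rightarrow> (complex, 'a) module) \<Rightarrow>
    (complex, 'b) module \<Rightarrow> ((nat \<Rightarrow> 'a) \<Rightarrow> 'b) \<Rightarrow> bool" where
  "multilinear_map K n X W A \<longleftrightarrow>
     A \<in> tuples n X \<rightarrow> carrier W \<and>
     (\<forall>x\<in>tuples n X. \<forall>i\<in>{1..n}.
        (\<forall>a\<in>carrier (X i). \<forall>b\<in>carrier (X i).
           A (x(i := a \<oplus>\<^bsub>X i\<^esub> b)) = A (x(i := a)) \<oplus>\<^bsub>W\<^esub> A (x(i := b))) \<and>
        (\<forall>c\<in>K. \<forall>a\<in>carrier (X i).
           A (x(i := c \<odot>\<^bsub>X i\<^esub> a)) = c \<odot>\<^bsub>W\<^esub> A (x(i := a))))"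

text \<open>
  The algebraic tensor product is constructed as in Ryan's \<^emph>\<open>Introduction to Tensor Products of
  Banach Spaces\<close>: the elementary tensor of \<open>x\<^sub>1, \<dots>, x\<^sub>n\<close> is the functional
  \<open>A \<mapsto> A (x\<^sub>1, \<dots>, x\<^sub>n)\<close> on the space of all (not necessarily bounded) multilinear forms, and the
  tensor product is the linear span of the elementary tensors. The universal property is
  proved below (\<open>tensor_universal_property\<close>).
\<close>

definition elem_tensor :: "complex set \<Rightarrow> nat \<Rightarrow> (nat \<Rightarrow> (complex, 'a) module) \<Rightarrow>
    (nat \<Rightarrow> 'a) \<Rightarrow> ((nat \<Rightarrow> 'a) \<Rightarrow> complex) \<Rightarrow> complex" where
  "elem_tensor K n X x = (\<lambda>A. if multilinear_map K n X (scalars K) A then A x else 0)"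

text \<open>
  The fields \<open>mult\<close> and \<open>one\<close> of a HOL-Algebra module record play no role in \<^locale>\<open>module\<close>.
\<close>

definition tensor_product :: "complex set \<Rightarrow> nat \<Rightarrow> (nat \<Rightarrow> (complex, 'a) module) \<Rightarrow>
    (complex, ((nat \<Rightarrow> 'a) \<Rightarrow> complex) \<Rightarrow> complex) module" where
  "tensor_product K n X =
     \<lparr>carrier = {z. \<exists>(m::nat) c x. (\<forall>i<m. c i \<in> K \<and> x i \<in> tuples n X) \<and>
                      z = (\<lambda>A. \<Sum>i<m. c i * elem_tensor K n X (x i) A)},
      mult = undefined, one = undefined,
      zero = (\<lambda>A. 0), add = (\<lambda>w z A. w A + z A), smult = (\<lambda>c z A. c * z A)\<rparr>"

text \<open>
  The functional \<open>f\<^sub>1 \<otimes> \<dots> \<otimes> f\<^sub>n\<close> evaluates a tensor at the multilinear form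
  \<open>x \<mapsto> f\<^sub>1 x\<^sub>1 \<cdots> f\<^sub>n x\<^sub>n\<close>; see \<open>tensor_functional_elem_tensor\<close> and \<open>linear_map_tensor_functional\<close>.
\<close>

definition tensor_functional ::
  "nat \<Rightarrow> (nat \<Rightarrow> 'a \<Rightarrow> complex) \<Rightarrow> (((nat \<Rightarrow> 'a) \<Rightarrow> complex) \<Rightarrow> complex) \<Rightarrow> complex" where
  "tensor_functional n f z = z (\<lambda>x. \<Prod>i\<in>{1..n}. f i (x i))"

definition reasonable_cross_norm :: "complex set \<Rightarrow> nat \<Rightarrow> (nat \<Rightarrow> (complex, 'a) module) \<Rightarrow>
    (nat \<Rightarrow> 'a \<Rightarrow> real) \<Rightarrow> ((((nat \<Rightarrow> 'a) \<Rightarrow> complex) \<Rightarrow> complex) \<Rightarrow> real) \<Rightarrow> bool" where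
  "reasonable_cross_norm K n X N \<alpha> \<longleftrightarrow>
     normed_space K (tensor_product K n X) \<alpha> \<and>
     (\<forall>x\<in>tuples n X. \<alpha> (elem_tensor K n X x) \<le> (\<Prod>i\<in>{1..n}. N i (x i))) \<and>
     (\<forall>f. (\<forall>i\<in>{1..n}. bounded_functional K (X i) (N i) (f i)) \<longrightarrow>
        bounded_functional K (tensor_product K n X) \<alpha> (tensor_functional n f) \<and>
        functional_norm (tensor_product K n X) \<alpha> (tensor_functional n f)
          \<le> (\<Prod>i\<in>{1..n}. functional_norm (X i) (N i) (f i)))"

definition tensor_rank :: "complex set \<Rightarrow> nat \<Rightarrow> (nat \<Rightarrow> (complex, 'a) module) \<Rightarrow>
    (((nat \<Rightarrow> 'a) \<Rightarrow> complex) \<Rightarrow> complex) \<Rightarrow> nat" where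
  "tensor_rank K n X z =
     (LEAST r. \<exists>x. (\<forall>i<r. x i \<in> tuples n X) \<and> z = (\<lambda>A. \<Sum>i<r. elem_tensor K n X (x i) A))"

definition rank_at_most :: "complex set \<Rightarrow> nat \<Rightarrow> (nat \<Rightarrow> (complex, 'a) module) \<Rightarrow> nat \<Rightarrow>
    (((nat \<Rightarrow> 'a) \<Rightarrow> complex) \<Rightarrow> complex) set" where
  "rank_at_most K n X r = {z \<in> carrier (tensor_product K n X). tensor_rank K n X z \<le> r}"


section \<open>Adequacy of the constructions\<close>

lemma scalars_simps [simp]:
  "carrier (scalars K) = K" "x \<otimes>\<^bsub>scalars K\<^esub> y = x * y" "\<one>\<^bsub>scalars K\<^esub> = 1"
  "\<zero>\<^bsub>scalars K\<^esub> = 0" "x \<oplus>\<^bsub>scalars K\<^esub> y = x + y" "x \<odot>\<^bsub>scalars K\<^esub> y = x * y"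
  by (simp_all add: scalars_def)

lemma tensor_product_simps [simp]:
  "\<zero>\<^bsub>tensor_product K n X\<^esub> = (\<lambda>A. 0)"
  "w \<oplus>\<^bsub>tensor_product K n X\<^esub> z = (\<lambda>A. w A + z A)"
  "c \<odot>\<^bsub>tensor_product K n X\<^esub> z = (\<lambda>A. c * z A)"
  by (simp_all add: tensor_product_def)

lemma scalars_closed:
  assumes "K = \<real> \<or> K = (UNIV :: complex set)"
  shows "0 \<in> K" "1 \<in> K" "a \<in> K \<Longrightarrow> b \<in> K \<Longrightarrow> a + b \<in> K" "a \<in> K \<Longrightarrow> b \<in> K \<Longrightarrow> a - b \<in> K"
    "a \<in> K \<Longrightarrow> b \<in> K \<Longrightarrow> a * b \<in> K" "a \<in> K \<Longrightarrow> - a \<in> K" "a \<in> K \<Longrightarrow> inverse a \<in> K"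
  using assms by auto

lemma cring_scalars:
  assumes "K = \<real> \<or> K = (UNIV :: complex set)"
  shows "cring (scalars K)"
proof (rule cringI)
  show "abelian_group (scalars K)"
  proof (rule abelian_groupI)
    fix x assume "x \<in> carrier (scalars K)"
    then show "\<exists>y\<in>carrier (scalars K). y \<oplus>\<^bsub>scalars K\<^esub> x = \<zero>\<^bsub>scalars K\<^esub>"
      by (intro bexI[of _ "- x"]) (simp_all add: scalars_closed[OF assms])
  qed (simp_all add: scalars_closed[OF assms])
  show "comm_monoid (scalars K)"
    by (rule comm_monoidI) (simp_all add: scalars_closed[OF assms])
qed (simp add: algebra_simps)

lemma carrier_tensorI:
  assumes "\<And>i. i < (m::nat) \<Longrightarrow> c i \<in> K" "\<And>i. i < m \<Longrightarrow> x i \<in> tuples n X"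
  shows "(\<lambda>A. \<Sum>i<m. c i * elem_tensor K n X (x i) A) \<in> carrier (tensor_product K n X)"
  unfolding tensor_product_def using assms
  by (simp, intro exI[of _ m] exI[of _ c] exI[of _ x]) simp

lemma carrier_tensorE:
  assumes "z \<in> carrier (tensor_product K n X)"
  obtains m :: nat and c x where "\<forall>i<m. c i \<in> K \<and> x i \<in> tuples n X"
    "z = (\<lambda>A. \<Sum>i<m. c i * elem_tensor K n X (x i) A)"
  using assms by (auto simp: tensor_product_def)

lemma elem_tensor_carrier:
  assumes "K = \<real> \<or> K = (UNIV :: complex set)" "x \<in> tuples n X"
  shows "elem_tensor K n X x \<in> carrier (tensor_product K n X)"
  using carrier_tensorI[of 1 "\<lambda>_. 1" K "\<lambda>_. x" n X] scalars_closed(2)[OF assms(1)] assms(2)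
  by simp

lemma tensor_add_closed:
  assumes "w \<in> carrier (tensor_product K n X)" "z \<in> carrier (tensor_product K n X)"
  shows "(\<lambda>A. w A + z A) \<in> carrier (tensor_product K n X)"
proof -
  obtain m :: nat and c x where "\<forall>i<m. c i \<in> K \<and> x i \<in> tuples n X" "w = (\<lambda>A. \<Sum>i<m. c i * elem_tensor K n X (x i) A)"
    by (rule carrier_tensorE[OF assms(1)]) (rule that; assumption)
  then have 1: "\<And>i. i < m \<Longrightarrow> c i \<in> K" "\<And>i. i < m \<Longrightarrow> x i \<in> tuples n X"
    "w = (\<lambda>A. \<Sum>i<m. c i * elem_tensor K n X (x i) A)"
    by blast+
  obtain l :: nat and d y where "\<forall>i<l. d i \<in> K \<and> y i \<in> tuples n X" "z = (\<lambda>A. \<Sum>i<l. d i * elem_tensor K n X (y i) A)"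
    by (rule carrier_tensorE[OF assms(2)]) (rule that; assumption)
  then have 2: "\<And>i. i < l \<Longrightarrow> d i \<in> K" "\<And>i. i < l \<Longrightarrow> y i \<in> tuples n X"
    "z = (\<lambda>A. \<Sum>i<l. d i * elem_tensor K n X (y i) A)"
    by blast+
  define e where "e i = (if i < m then c i else d (i - m))" for i
  define u where "u i = (if i < m then x i else y (i - m))" for i
  have split: "(\<Sum>i<m + l. g i) = (\<Sum>i<m. g i) + (\<Sum>i<l. g (m + i))" for g :: "nat \<Rightarrow> complex"
    by (induction l) (simp_all add: add.assoc)
  have "(\<lambda>A. w A + z A) = (\<lambda>A. \<Sum>i<m + l. e i * elem_tensor K n X (u i) A)"
    unfolding split by (simp add: 1 2 e_def u_def)
  moreover have "\<dots> \<in> carrier (tensor_product K n X)"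
    by (rule carrier_tensorI) (auto simp: e_def u_def 1 2)
  ultimately show ?thesis by simp
qed

lemma tensor_smult_closed:
  assumes "K = \<real> \<or> K = (UNIV :: complex set)"
    and "z \<in> carrier (tensor_product K n X)" "c \<in> K"
  shows "(\<lambda>A. c * z A) \<in> carrier (tensor_product K n X)"
proof -
  obtain m :: nat and d x where "\<forall>i<m. d i \<in> K \<and> x i \<in> tuples n X" "z = (\<lambda>A. \<Sum>i<m. d i * elem_tensor K n X (x i) A)"
    by (rule carrier_tensorE[OF assms(2)]) (rule that; assumption)
  then have 1: "\<And>i. i < m \<Longrightarrow> d i \<in> K" "\<And>i. i < m \<Longrightarrow> x i \<in> tuples n X"
    "z = (\<lambda>A. \<Sum>i<m. d i * elem_tensor K n X (x i) A)"
    by blast+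
  have "(\<lambda>A. c * z A) = (\<lambda>A. \<Sum>i<m. (c * d i) * elem_tensor K n X (x i) A)"
    by (simp add: 1 sum_distrib_left mult.assoc)
  moreover have "\<dots> \<in> carrier (tensor_product K n X)"
    by (rule carrier_tensorI) (auto simp: 1 assms scalars_closed[OF assms(1)])
  ultimately show ?thesis by simp
qed

lemma module_tensor_product:
  assumes K: "K = \<real> \<or> K = (UNIV :: complex set)"
  shows "module (scalars K) (tensor_product K n X)"
proof (rule moduleI)
  show "abelian_group (tensor_product K n X)"
  proof (rule abelian_groupI)
    show "\<zero>\<^bsub>tensor_product K n X\<^esub> \<in> carrier (tensor_product K n X)"
      using carrier_tensorI[of 0 undefined K undefined n X] by simp
    fix z assume "z \<in> carrier (tensor_product K n X)"
    then show "\<exists>y\<in>carrier (tensor_product K n X).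
        y \<oplus>\<^bsub>tensor_product K n X\<^esub> z = \<zero>\<^bsub>tensor_product K n X\<^esub>"
      using tensor_smult_closed[OF K, of z n X "-1"]
      by (intro bexI[of _ "\<lambda>A. -1 * z A"]) (simp_all add: scalars_closed[OF K])
  qed (simp_all add: tensor_add_closed algebra_simps)
qed (simp_all add: cring_scalars[OF K] tensor_smult_closed[OF K] algebra_simps)

lemma multilinear_elem_tensor:
  assumes "K = \<real> \<or> K = (UNIV :: complex set)"
  shows "multilinear_map K n X (tensor_product K n X) (elem_tensor K n X)"
  using elem_tensor_carrier[OF assms]
  by (auto simp: multilinear_map_def elem_tensor_def fun_eq_iff)

lemma multilinear_prod:
  assumes K: "K = \<real> \<or> K = (UNIV :: complex set)"
    and f: "\<And>i. i \<in> {1..n} \<Longrightarrow> linear_map K (X i) (scalars K) (f i)"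
  shows "multilinear_map K n X (scalars K) (\<lambda>x. \<Prod>i\<in>{1..n}. f i (x i))"
proof -
  have fK: "f i a \<in> K" if "i \<in> {1..n}" "a \<in> carrier (X i)" for i a
    using f[OF that(1)] that(2) by (auto simp: linear_map_def)
  have 1: "(\<Prod>i\<in>I. f i (x i)) \<in> K" if "x \<in> tuples n X" "finite I" "I \<subseteq> {1..n}" for x I
    using that(2,3)
  proof (induction rule: finite_induct)
    case (insert i I)
    then have "x i \<in> carrier (X i)" using that(1) by (auto simp: tuples_def)
    then show ?case using insert fK by (simp add: scalars_closed[OF K])
  qed (simp add: scalars_closed[OF K])
  have upd: "(\<Prod>j\<in>{1..n}. f j ((x(i := a)) j)) = f i a * (\<Prod>j\<in>{1..n} - {i}. f j (x j))"
    if "i \<in> {1..n}" for x i a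
    using that by (subst prod.remove[of _ i]) auto
  show ?thesis
    unfolding multilinear_map_def
  proof (intro conjI ballI)
    fix x i a b assume *: "x \<in> tuples n X" "i \<in> {1..n}" "a \<in> carrier (X i)" "b \<in> carrier (X i)"
    then have "f i (a \<oplus>\<^bsub>X i\<^esub> b) = f i a + f i b"
      using f[of i] by (auto simp: linear_map_def)
    then show "(\<Prod>j\<in>{1..n}. f j ((x(i := a \<oplus>\<^bsub>X i\<^esub> b)) j)) =
      (\<Prod>j\<in>{1..n}. f j ((x(i := a)) j)) \<oplus>\<^bsub>scalars K\<^esub> (\<Prod>j\<in>{1..n}. f j ((x(i := b)) j))"
      unfolding upd[OF *(2)] by (simp add: distrib_right)
  next
    fix x i c a assume *: "x \<in> tuples n X" "i \<in> {1..n}" "c \<in> K" "a \<in> carrier (X i)"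
    then have "f i (c \<odot>\<^bsub>X i\<^esub> a) = c * f i a"
      using f[of i] by (auto simp: linear_map_def)
    then show "(\<Prod>j\<in>{1..n}. f j ((x(i := c \<odot>\<^bsub>X i\<^esub> a)) j)) =
      c \<odot>\<^bsub>scalars K\<^esub> (\<Prod>j\<in>{1..n}. f j ((x(i := a)) j))"
      unfolding upd[OF *(2)] by simp
  qed (use 1 in auto)
qed

lemma tensor_functional_elem_tensor:
  assumes "K = \<real> \<or> K = (UNIV :: complex set)"
    and "\<And>i. i \<in> {1..n} \<Longrightarrow> linear_map K (X i) (scalars K) (f i)"
  shows "tensor_functional n f (elem_tensor K n X x) = (\<Prod>i\<in>{1..n}. f i (x i))"
  using multilinear_prod[where X = X and f = f and n = n, OF assms]
  by (simp add: tensor_functional_def elem_tensor_def)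

lemma tensor_eval_closed:
  assumes K: "K = \<real> \<or> K = (UNIV :: complex set)"
    and "z \<in> carrier (tensor_product K n X)"
  shows "z A \<in> K"
proof -
  obtain m :: nat and d x where "\<forall>i<m. d i \<in> K \<and> x i \<in> tuples n X" "z = (\<lambda>A. \<Sum>i<m. d i * elem_tensor K n X (x i) A)"
    by (rule carrier_tensorE[OF assms(2)]) (rule that; assumption)
  then have 1: "\<And>i. i < m \<Longrightarrow> d i \<in> K" "\<And>i. i < m \<Longrightarrow> x i \<in> tuples n X"
    "z = (\<lambda>A. \<Sum>i<m. d i * elem_tensor K n X (x i) A)"
    by blast+
  have "elem_tensor K n X (x i) A \<in> K" if "i < m" for i
    using 1(2)[OF that] scalars_closed(1)[OF K]
    by (auto simp: elem_tensor_def multilinear_map_def)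
  then have "(\<Sum>i<k. d i * elem_tensor K n X (x i) A) \<in> K" if "k \<le> m" for k
    using that by (induction k) (simp_all add: scalars_closed(1,3,5)[OF K] 1(1))
  then show ?thesis unfolding 1(3) by simp
qed

lemma linear_map_tensor_functional:
  assumes "K = \<real> \<or> K = (UNIV :: complex set)"
  shows "linear_map K (tensor_product K n X) (scalars K) (tensor_functional n f)"
proof -
  have "tensor_functional n f \<in> carrier (tensor_product K n X) \<rightarrow> carrier (scalars K)"
  proof (rule Pi_I)
    fix z assume z: "z \<in> carrier (tensor_product K n X)"
    show "tensor_functional n f z \<in> carrier (scalars K)"
      unfolding tensor_functional_def scalars_simps by (rule tensor_eval_closed[OF assms z])
  qed
  then show ?thesis by (simp add: linear_map_def tensor_functional_def)
qed

lemma functionals_separate_points: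
  fixes W :: "(complex, 'b) module" (structure)
  assumes K: "K = \<real> \<or> K = (UNIV :: complex set)"
    and W: "module (scalars K) W" and w: "w \<in> carrier W" "w \<noteq> \<zero>"
  obtains f where "linear_map K W (scalars K) f" "f w \<noteq> 0"
proof -
  interpret module "scalars K" W by (rule W)
  note K' = scalars_closed[OF K]
  have smc [simp]: "c \<odot> x \<in> carrier W" if "c \<in> K" "x \<in> carrier W" for c x
    using smult_closed[of c x] that by simp
  have sml: "(a + b) \<odot> x = a \<odot> x \<oplus> b \<odot> x" if "a \<in> K" "b \<in> K" "x \<in> carrier W" for a b x
    using smult_l_distr[of a b x] that by simp
  have smr: "a \<odot> (x \<oplus> y) = a \<odot> x \<oplus> a \<odot> y" if "a \<in> K" "x \<in> carrier W" "y \<in> carrier W" for a x y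
    using smult_r_distr[of a x y] that by simp
  have sma: "(a * b) \<odot> x = a \<odot> (b \<odot> x)" if "a \<in> K" "b \<in> K" "x \<in> carrier W" for a b x
    using smult_assoc1[of a b x] that by simp
  have sm1: "1 \<odot> x = x" if "x \<in> carrier W" for x
    using smult_one[of x] that by simp
  have sm0: "0 \<odot> x = \<zero>" if "x \<in> carrier W" for x
    using smult_l_null[of x] that by simp
  define sub where "sub U \<longleftrightarrow> U \<subseteq> carrier W \<and> \<zero> \<in> U \<and> (\<forall>x\<in>U. \<forall>y\<in>U. x \<oplus> y \<in> U) \<and>
    (\<forall>c\<in>K. \<forall>x\<in>U. c \<odot> x \<in> U)" for U
  define F where "F = {U. sub U \<and> w \<notin> U}"
  have "{\<zero>} \<in> F"
    using w smult_r_null by (auto simp: F_def sub_def)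
  moreover have "\<Union>C \<in> F" if "C \<noteq> {}" "subset.chain F C" for C
  proof -
    have CF: "\<And>U. U \<in> C \<Longrightarrow> sub U \<and> w \<notin> U" and lin: "\<And>U V. U \<in> C \<Longrightarrow> V \<in> C \<Longrightarrow> U \<subseteq> V \<or> V \<subseteq> U"
      using that(2) by (auto simp: subset.chain_def F_def)
    have "x \<oplus> y \<in> \<Union>C" if "x \<in> \<Union>C" "y \<in> \<Union>C" for x y
    proof -
      obtain U V where "U \<in> C" "x \<in> U" "V \<in> C" "y \<in> V" using \<open>x \<in> \<Union>C\<close> \<open>y \<in> \<Union>C\<close> by auto
      then obtain Z where "Z \<in> C" "x \<in> Z" "y \<in> Z" using lin[of U V] by blast
      then show ?thesis using CF[of Z] unfolding sub_def by blast
    qed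
    then have "\<forall>x\<in>\<Union>C. \<forall>y\<in>\<Union>C. x \<oplus> y \<in> \<Union>C" by blast
    moreover have "\<forall>c\<in>K. \<forall>x\<in>\<Union>C. c \<odot> x \<in> \<Union>C"
      using CF unfolding sub_def by blast
    moreover have "\<Union>C \<subseteq> carrier W" "w \<notin> \<Union>C" using CF unfolding sub_def by blast+
    moreover have "\<zero> \<in> \<Union>C" using CF that(1) unfolding sub_def by blast
    ultimately show ?thesis unfolding F_def sub_def by blast
  qed
  ultimately obtain U where U: "U \<in> F" and max: "\<And>V. V \<in> F \<Longrightarrow> U \<subseteq> V \<Longrightarrow> V = U"
    using subset_Zorn_nonempty[of F] by blast
  have sU: "U \<subseteq> carrier W" "\<zero> \<in> U" "\<And>x y. x \<in> U \<Longrightarrow> y \<in> U \<Longrightarrow> x \<oplus> y \<in> U"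
    "\<And>c x. c \<in> K \<Longrightarrow> x \<in> U \<Longrightarrow> c \<odot> x \<in> U" and wU: "w \<notin> U"
    using U by (auto simp: F_def sub_def)
  have cU: "u \<in> carrier W" if "u \<in> U" for u using sU(1) that by auto
  have dec: "\<exists>c. c \<in> K \<and> (\<exists>u\<in>U. v = u \<oplus> c \<odot> w)" if v: "v \<in> carrier W" for v
  proof (cases "v \<in> U")
    case True
    then show ?thesis
      using w v by (intro exI[of _ 0] conjI bexI[of _ v]) (simp_all add: sm0 K')
  next
    case False
    define V where "V = {u \<oplus> d \<odot> v | u d. u \<in> U \<and> d \<in> K}"
    have VI: "u \<oplus> d \<odot> v \<in> V" if "u \<in> U" "d \<in> K" for u d
      using that unfolding V_def by blast
    have "U \<subseteq> V"
    proof
      fix u assume "u \<in> U"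
      then have "u = u \<oplus> 0 \<odot> v" using v cU by (simp add: sm0)
      then show "u \<in> V" using VI[OF \<open>u \<in> U\<close> K'(1)] by simp
    qed
    have "v = \<zero> \<oplus> 1 \<odot> v" using v by (simp add: sm1)
    then have "v \<in> V" using VI[OF sU(2) K'(2)] by simp
    have "sub V"
      unfolding sub_def
    proof (intro conjI ballI)
      show "V \<subseteq> carrier W" using v cU by (auto simp: V_def)
      show "\<zero> \<in> V" using \<open>U \<subseteq> V\<close> sU(2) by auto
    next
      fix x y assume "x \<in> V" "y \<in> V"
      then obtain u d u' d' where *: "u \<in> U" "d \<in> K" "u' \<in> U" "d' \<in> K"
        "x = u \<oplus> d \<odot> v" "y = u' \<oplus> d' \<odot> v" by (auto simp: V_def)
      then have "x \<oplus> y = (u \<oplus> u') \<oplus> (d + d') \<odot> v"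
        using v cU by (simp add: sml M.a_ac)
      then show "x \<oplus> y \<in> V" using VI[OF sU(3)[OF *(1,3)] K'(3)[OF *(2,4)]] by simp
    next
      fix c x assume "c \<in> K" "x \<in> V"
      then obtain u d where *: "u \<in> U" "d \<in> K" "x = u \<oplus> d \<odot> v" by (auto simp: V_def)
      then have "c \<odot> x = c \<odot> u \<oplus> (c * d) \<odot> v"
        using v cU \<open>c \<in> K\<close> by (simp add: smr sma)
      then show "c \<odot> x \<in> V"
        using VI[OF sU(4)[OF \<open>c \<in> K\<close> *(1)] K'(5)[OF \<open>c \<in> K\<close> *(2)]] by simp
    qed
    then have "w \<in> V"
      using max[of V] \<open>U \<subseteq> V\<close> \<open>v \<in> V\<close> False by (auto simp: F_def)
    then obtain u d where *: "u \<in> U" "d \<in> K" "w = u \<oplus> d \<odot> v" by (auto simp: V_def)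
    have "d \<noteq> 0"
    proof
      assume "d = 0"
      then have "w = u" using *(1,3) v cU by (simp add: sm0)
      then show False using wU *(1) by simp
    qed
    have m1: "- 1 \<in> K" by (rule K'(6)[OF K'(2)])
    have "d \<odot> v = (-1) \<odot> u \<oplus> w"
    proof -
      have "(-1) \<odot> u \<oplus> u = (-1 + 1) \<odot> u"
        using cU[OF *(1)] K' by (subst sml) (simp_all add: sm1)
      then have "(-1) \<odot> u \<oplus> u = \<zero>" using cU[OF *(1)] by (simp add: sm0)
      moreover have "(-1) \<odot> u \<oplus> w = ((-1) \<odot> u \<oplus> u) \<oplus> d \<odot> v"
        unfolding *(3) using *(1,2) cU v m1 by (simp add: M.a_assoc)
      ultimately show ?thesis using v *(2) by simp
    qed
    then have "inverse d \<odot> (d \<odot> v) = inverse d \<odot> ((-1) \<odot> u) \<oplus> inverse d \<odot> w"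
      using *(1,2) cU w K' by (simp add: smr)
    moreover have "inverse d \<odot> (d \<odot> v) = v"
      using sma[of "inverse d" d v] \<open>d \<noteq> 0\<close> *(2) v K' by (simp add: sm1)
    moreover have "inverse d \<odot> ((-1) \<odot> u) \<in> U"
      by (rule sU(4)[OF K'(7)[OF *(2)] sU(4)[OF m1 *(1)]])
    moreover have "inverse d \<in> K" by (rule K'(7)[OF *(2)])
    ultimately show ?thesis by metis
  qed
  have uniq: "c = c'" if "u \<in> U" "u' \<in> U" "c \<in> K" "c' \<in> K" "u \<oplus> c \<odot> w = u' \<oplus> c' \<odot> w" for u u' c c'
  proof (rule ccontr)
    assume "c \<noteq> c'"
    have neg: "(-1) \<odot> u \<oplus> u = \<zero>"
      using sml[of "-1" 1 u] cU[OF that(1)] K' by (simp add: sm0 sm1)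
    have "(c - c') \<odot> w = c \<odot> w \<oplus> (- c') \<odot> w"
      using sml[of c "- c'" w] w that K' by simp
    also have "c \<odot> w = ((-1) \<odot> u \<oplus> u) \<oplus> c \<odot> w" using neg w that by simp
    also have "\<dots> = (-1) \<odot> u \<oplus> (u' \<oplus> c' \<odot> w)" using that cU w K' by (simp add: M.a_assoc)
    also have "\<dots> \<oplus> (- c') \<odot> w = ((-1) \<odot> u \<oplus> u') \<oplus> (c' \<odot> w \<oplus> (- c') \<odot> w)"
      using that cU w K' by (simp add: M.a_assoc)
    also have "c' \<odot> w \<oplus> (- c') \<odot> w = \<zero>"
      using sml[of c' "- c'" w] w that K' by (simp add: sm0)
    finally have "(c - c') \<odot> w = (-1) \<odot> u \<oplus> u'" using that cU K' by simp
    then have "(c - c') \<odot> w \<in> U" using that sU K' by simp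
    then have "inverse (c - c') \<odot> ((c - c') \<odot> w) \<in> U" using that sU K' by simp
    moreover have "inverse (c - c') \<odot> ((c - c') \<odot> w) = w"
      using sma[of "inverse (c - c')" "c - c'" w] \<open>c \<noteq> c'\<close> that w K' by (simp add: sm1)
    ultimately show False using wU by simp
  qed
  define f where "f v = (THE c. c \<in> K \<and> (\<exists>u\<in>U. v = u \<oplus> c \<odot> w))" for v
  have fI: "f (u \<oplus> c \<odot> w) = c" if "u \<in> U" "c \<in> K" for u c
    unfolding f_def
  proof (rule the_equality)
    show "c \<in> K \<and> (\<exists>u'\<in>U. u \<oplus> c \<odot> w = u' \<oplus> c \<odot> w)" using that by blast
    fix d assume "d \<in> K \<and> (\<exists>u'\<in>U. u \<oplus> c \<odot> w = u' \<oplus> d \<odot> w)"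
    then obtain u' where "d \<in> K" "u' \<in> U" "u \<oplus> c \<odot> w = u' \<oplus> d \<odot> w" by blast
    then show "d = c" using uniq[of u u' c d] that by simp
  qed
  have "linear_map K W (scalars K) f"
    unfolding linear_map_def
  proof (intro conjI ballI)
    show "f \<in> carrier W \<rightarrow> carrier (scalars K)"
    proof (rule Pi_I)
      fix v assume "v \<in> carrier W"
      then obtain u c where "u \<in> U" "c \<in> K" "v = u \<oplus> c \<odot> w" using dec by metis
      then show "f v \<in> carrier (scalars K)" by (simp add: fI)
    qed
  next
    fix x y assume "x \<in> carrier W" "y \<in> carrier W"
    then obtain u c u' c' where *: "u \<in> U" "c \<in> K" "x = u \<oplus> c \<odot> w" "u' \<in> U" "c' \<in> K" "y = u' \<oplus> c' \<odot> w"
      using dec by metis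
    then have "x \<oplus> y = (u \<oplus> u') \<oplus> (c + c') \<odot> w"
      using w cU by (simp add: sml M.a_ac)
    then have "f (x \<oplus> y) = c + c'" using * sU K' by (simp add: fI)
    then show "f (x \<oplus> y) = f x \<oplus>\<^bsub>scalars K\<^esub> f y" using * fI by simp
  next
    fix d x assume "d \<in> K" "x \<in> carrier W"
    then obtain u c where *: "u \<in> U" "c \<in> K" "x = u \<oplus> c \<odot> w" using dec by metis
    then have "d \<odot> x = d \<odot> u \<oplus> (d * c) \<odot> w"
      using w cU \<open>d \<in> K\<close> by (simp add: smr sma)
    then have "f (d \<odot> x) = d * c" using * sU K' \<open>d \<in> K\<close> by (simp add: fI)
    then show "f (d \<odot> x) = d \<odot>\<^bsub>scalars K\<^esub> f x" using * fI by simp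
  qed
  moreover have "f w \<noteq> 0"
    using fI[of "\<zero>" 1] sU(2) w K' by (simp add: sm1)
  ultimately show ?thesis using that by blast
qed

lemma linear_comp_multilinear:
  assumes "multilinear_map K n X W A" "linear_map K W (scalars K) f"
  shows "multilinear_map K n X (scalars K) (\<lambda>x. f (A x))"
proof -
  have upd: "x(i := a) \<in> tuples n X" if "x \<in> tuples n X" "i \<in> {1..n}" "a \<in> carrier (X i)" for x i a
    using that by (auto simp: tuples_def PiE_iff extensional_def)
  have cl: "A x \<in> carrier W" if "x \<in> tuples n X" for x
    using assms(1) that by (auto simp: multilinear_map_def)
  have fcl: "f v \<in> K" if "v \<in> carrier W" for v
    using assms(2) that by (auto simp: linear_map_def)
  have fadd: "f (v \<oplus>\<^bsub>W\<^esub> v') = f v + f v'" if "v \<in> carrier W" "v' \<in> carrier W" for v v'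
    using assms(2) that by (auto simp: linear_map_def)
  have fsm: "f (c \<odot>\<^bsub>W\<^esub> v) = c * f v" if "c \<in> K" "v \<in> carrier W" for v c
    using assms(2) that by (auto simp: linear_map_def)
  show ?thesis
    unfolding multilinear_map_def
  proof (intro conjI ballI)
    fix x i a b assume *: "x \<in> tuples n X" "i \<in> {1..n}" "a \<in> carrier (X i)" "b \<in> carrier (X i)"
    then have "A (x(i := a \<oplus>\<^bsub>X i\<^esub> b)) = A (x(i := a)) \<oplus>\<^bsub>W\<^esub> A (x(i := b))"
      using assms(1) unfolding multilinear_map_def by blast
    then show "f (A (x(i := a \<oplus>\<^bsub>X i\<^esub> b))) = f (A (x(i := a))) \<oplus>\<^bsub>scalars K\<^esub> f (A (x(i := b)))"
      using fadd[OF cl[OF upd] cl[OF upd]] * by simp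
  next
    fix x i c a assume *: "x \<in> tuples n X" "i \<in> {1..n}" "c \<in> K" "a \<in> carrier (X i)"
    then have "A (x(i := c \<odot>\<^bsub>X i\<^esub> a)) = c \<odot>\<^bsub>W\<^esub> A (x(i := a))"
      using assms(1) unfolding multilinear_map_def by blast
    then show "f (A (x(i := c \<odot>\<^bsub>X i\<^esub> a))) = c \<odot>\<^bsub>scalars K\<^esub> f (A (x(i := a)))"
      using fsm[OF _ cl[OF upd]] * by simp
  qed (use cl fcl in auto)
qed

text \<open>
  Uniqueness of \<open>L\<close> on the tensor product is immediate, since the elementary tensors span it.
\<close>

theorem tensor_universal_property:
  fixes W :: "(complex, 'b) module" (structure)
  assumes K: "K = \<real> \<or> K = (UNIV :: complex set)"
    and W: "module (scalars K) W" and \<phi>: "multilinear_map K n X W \<phi>"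
  shows "\<exists>L. linear_map K (tensor_product K n X) W L \<and>
             (\<forall>x\<in>tuples n X. L (elem_tensor K n X x) = \<phi> x)"
proof -
  interpret module "scalars K" W by (rule W)
  let ?T = "tensor_product K n X"
  let ?lin = "linear_map K W (scalars K)"
  have smc [simp]: "c \<odot> x \<in> carrier W" if "c \<in> K" "x \<in> carrier W" for c x
    using smult_closed[of c x] that by simp
  have fadd: "f (v \<oplus> v') = f v + f v'" if "?lin f" "v \<in> carrier W" "v' \<in> carrier W" for f v v'
    using that by (auto simp: linear_map_def)
  have fsm: "f (c \<odot> v) = c * f v" if "?lin f" "c \<in> K" "v \<in> carrier W" for f v c
    using that by (auto simp: linear_map_def)
  have \<phi>c: "\<phi> x \<in> carrier W" if "x \<in> tuples n X" for x
    using \<phi> that by (auto simp: multilinear_map_def)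
  have eqI: "v = v'" if "v \<in> carrier W" "v' \<in> carrier W" "\<And>f. ?lin f \<Longrightarrow> f v = f v'" for v v'
  proof (rule ccontr)
    assume "v \<noteq> v'"
    have m1: "-1 \<in> K" by (rule scalars_closed(6)[OF K scalars_closed(2)[OF K]])
    have ne: "v \<oplus> (-1) \<odot> v' \<noteq> \<zero>"
    proof
      assume "v \<oplus> (-1) \<odot> v' = \<zero>"
      moreover have "v' \<oplus> (-1) \<odot> v' = \<zero>"
        using smult_l_distr[of 1 "-1" v'] smult_one[of v'] smult_l_null[of v'] that(2) m1
          scalars_closed(2)[OF K]
        by simp
      ultimately have "v \<oplus> (-1) \<odot> v' = v' \<oplus> (-1) \<odot> v'" by simp
      then have "v = v'"
        using M.add.right_cancel[OF smc[OF m1 that(2)] that(1,2)] by simp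
      then show False using \<open>v \<noteq> v'\<close> by simp
    qed
    have vv: "v \<oplus> (-1) \<odot> v' \<in> carrier W" by (rule M.a_closed[OF that(1) smc[OF m1 that(2)]])
    from ne obtain f where "?lin f" "f (v \<oplus> (-1) \<odot> v') \<noteq> 0"
      using functionals_separate_points[OF K W vv] by blast
    then show False using that(3)[of f] that m1 by (simp add: fadd fsm)
  qed
  define P where "P z v \<longleftrightarrow> v \<in> carrier W \<and> (\<forall>f. ?lin f \<longrightarrow> f v = z (\<lambda>x. f (\<phi> x)))" for z v
  have uniq: "v = v'" if "P z v" "P z v'" for z v v'
    by (rule eqI) (use that[unfolded P_def] in metis)+
  have P_elem: "P (elem_tensor K n X x) (\<phi> x)" if "x \<in> tuples n X" for x
    using that \<phi>c linear_comp_multilinear[OF \<phi>] by (auto simp: P_def elem_tensor_def)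
  have P_add: "P (\<lambda>A. w A + z A) (v \<oplus> v')" if "P w v" "P z v'" for w z v v'
    using that by (auto simp: P_def fadd)
  have P_smult: "P (\<lambda>A. c * z A) (c \<odot> v)" if "c \<in> K" "P z v" for c z v
    using that by (auto simp: P_def fsm)
  have P_zero: "P (\<lambda>A. 0) \<zero>"
  proof -
    have "f \<zero> = 0" if "?lin f" for f
      using fadd[OF that, of \<zero> \<zero>] by simp
    then show ?thesis by (simp add: P_def)
  qed
  have ex: "\<exists>v. P z v" if z: "z \<in> carrier ?T" for z
  proof -
    obtain m :: nat and d x where "\<forall>i<m. d i \<in> K \<and> x i \<in> tuples n X" "z = (\<lambda>A. \<Sum>i<m. d i * elem_tensor K n X (x i) A)"
    by (rule carrier_tensorE[OF z]) (rule that; assumption)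
  then have 1: "\<And>i. i < m \<Longrightarrow> d i \<in> K" "\<And>i. i < m \<Longrightarrow> x i \<in> tuples n X"
    "z = (\<lambda>A. \<Sum>i<m. d i * elem_tensor K n X (x i) A)"
    by blast+
    have "\<exists>v. P (\<lambda>A. \<Sum>i<k. d i * elem_tensor K n X (x i) A) v" if "k \<le> m" for k
      using that
    proof (induction k)
      case 0
      show ?case using P_zero by (intro exI[of _ \<zero>]) simp
    next
      case (Suc k)
      then have k: "k < m" by simp
      with Suc obtain v where "P (\<lambda>A. \<Sum>i<k. d i * elem_tensor K n X (x i) A) v" by auto
      from P_add[OF this P_smult[OF 1(1)[OF k] P_elem[OF 1(2)[OF k]]]]
      show ?case by (intro exI[of _ "v \<oplus> d k \<odot> \<phi> (x k)"]) simp
    qed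
    from this[OF order_refl] show ?thesis unfolding 1(3) .
  qed
  define L where "L z = (SOME v. P z v)" for z
  have PL: "P z (L z)" if "z \<in> carrier ?T" for z
    unfolding L_def using ex[OF that] by (rule someI_ex)
  have "linear_map K ?T W L"
    unfolding linear_map_def tensor_product_simps
  proof (intro conjI ballI)
    show "L \<in> carrier ?T \<rightarrow> carrier W" using PL by (auto simp: P_def)
  next
    fix w z assume "w \<in> carrier ?T" "z \<in> carrier ?T"
    then show "L (\<lambda>A. w A + z A) = L w \<oplus> L z"
      by (intro uniq[OF PL P_add] PL tensor_add_closed)
  next
    fix c z assume "c \<in> K" "z \<in> carrier ?T"
    then show "L (\<lambda>A. c * z A) = c \<odot> L z"
      by (intro uniq[OF PL P_smult] PL tensor_smult_closed[OF K])
  qed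
  moreover have "L (elem_tensor K n X x) = \<phi> x" if "x \<in> tuples n X" for x
    by (rule uniq[OF PL[OF elem_tensor_carrier[OF K that]] P_elem[OF that]])
  ultimately show ?thesis by blast
qed

end

theory Submission
  imports Defs "Jordan_Normal_Form.Determinant"
begin

text \<open>
  Let \<open>z = \<Sum>\<^sub>i c\<^sub>i x\<^sup>i\<^sub>1 \<otimes> \<dots> \<otimes> x\<^sup>i\<^sub>n\<close> have at most \<open>r\<close> summands. In each of the first \<open>n - 1\<close> slots expand
  the \<open>x\<^sup>i\<^sub>j\<close> in a basis of their span whose vectors and coordinate functionals have norm at most \<open>1\<close>,
  up to a factor \<open>\<delta> > 1\<close>. Then \<open>z\<close> becomes a sum of at most \<open>r\<^sup>n\<^sup>-\<^sup>1\<close> elementary tensors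
  \<open>e\<^sub>1 \<otimes> \<dots> \<otimes> e\<^sub>n\<^sub>-\<^sub>1 \<otimes> y\<close>, and by Hahn-Banach \<open>\<parallel>y\<parallel>\<close> is the value on \<open>z\<close> of a product functional of norm
  at most \<open>1\<close>, hence \<open>\<parallel>y\<parallel> \<le> \<beta> z\<close>. Letting \<open>\<delta> \<rightarrow> 1\<close> gives \<open>\<alpha> z \<le> r\<^sup>n\<^sup>-\<^sup>1 \<beta> z\<close>, and a difference of two tensors
  of rank at most \<open>r\<close> has at most \<open>2r\<close> summands. Working with \<open>\<delta> > 1\<close> instead of an exact Auerbach
  basis, the determinant only has to be maximized approximately, so no compactness is needed.
\<close>

section \<open>Determinants of families of scalars\<close>

text \<open>Rows are indexed by plain functions, so that replacing row \<open>j\<close> is the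
  update \<open>a(j := v)\<close> that Cramer's rule asks for.\<close>

definition family_det :: "nat \<Rightarrow> (nat \<Rightarrow> nat \<Rightarrow> complex) \<Rightarrow> complex" where
  "family_det d a = det (mat d d (\<lambda>(j, l). a j l))"

definition family_cofactor :: "nat \<Rightarrow> (nat \<Rightarrow> nat \<Rightarrow> complex) \<Rightarrow> nat \<Rightarrow> nat \<Rightarrow> complex" where
  "family_cofactor d a j l = cofactor (mat d d (\<lambda>(j, l). a j l)) j l"

lemma family_det_leibniz:
  "family_det d a = (\<Sum>p | p permutes {0..<d}. signof p * (\<Prod>i = 0..<d. a i (p i)))"
proof -
  have "p i < d" if "p permutes {0..<d}" "i < d" for p i
    using permutes_in_image[OF that(1), of i] that(2) by simp
  then show ?thesis
    unfolding family_det_def by (subst det_def'[of _ d]) (auto intro!: sum.cong prod.cong)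
qed

text \<open>This keeps the Cramer quotients inside the scalar field when
  \<open>K = \<real>\<close>.\<close>

lemma family_det_Reals:
  assumes "\<And>j l. j < d \<Longrightarrow> l < d \<Longrightarrow> a j l \<in> \<real>"
  shows "family_det d a \<in> \<real>"
  unfolding family_det_leibniz
proof (intro sum_in_Reals Reals_mult prod_in_Reals)
  fix p i assume p: "p \<in> {p. p permutes {0..<d}}"
  show "(signof p :: complex) \<in> \<real>" by simp
  assume "i \<in> {0..<d}"
  then show "a i (p i) \<in> \<real>" using permutes_in_image[of p "{0..<d}" i] p assms by simp
qed

text \<open>The Leibniz sum has \<open>fact d\<close> terms, each of modulus at most
  \<open>B ^ d\<close>. The bound makes the supremum of determinants in
  \<open>near_auerbach_span\<close> finite.\<close>

lemma cmod_family_det_le: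
  assumes "\<And>j l. j < d \<Longrightarrow> l < d \<Longrightarrow> cmod (a j l) \<le> B"
  shows "cmod (family_det d a) \<le> fact d * B ^ d"
proof -
  have "cmod (signof p * (\<Prod>i = 0..<d. a i (p i))) \<le> B ^ d" if p: "p permutes {0..<d}" for p
  proof -
    have "cmod (signof p :: complex) = 1" by (simp add: sign_def)
    moreover have "(\<Prod>i = 0..<d. cmod (a i (p i))) \<le> (\<Prod>i = 0..<d. B)"
      using permutes_in_image[OF p] assms by (intro prod_mono) simp
    ultimately show ?thesis by (simp add: norm_mult prod_norm)
  qed
  then have "cmod (family_det d a) \<le> real (card {p. p permutes {0..<d}}) * B ^ d"
    unfolding family_det_leibniz by (intro sum_norm_bound) simp
  then show ?thesis by (simp add: card_permutations[where n = d])
qed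

text \<open>A diagonal matrix is triangular, so only a vanishing diagonal entry can make its
  determinant zero. This makes the supremum in \<open>near_auerbach_span\<close> positive.\<close>

lemma family_det_diag:
  assumes "\<And>j l. j < d \<Longrightarrow> l < d \<Longrightarrow> j \<noteq> l \<Longrightarrow> a j l = 0" "\<And>j. j < d \<Longrightarrow> a j j \<noteq> 0"
  shows "family_det d a \<noteq> 0"
proof -
  have "upper_triangular (mat d d (\<lambda>(j, l). a j l))"
    using assms(1) by auto
  then show ?thesis
    unfolding family_det_def
    by (subst upper_triangular_imp_det_eq_0_iff[of _ d]) (auto simp: diag_mat_def assms(2))
qed

text \<open>Laplace expansion along row \<open>j\<close>. The cofactors of a row do not see its
  entries, so the determinant is linear in the replacement \<open>v\<close>.\<close>

lemma family_det_update:
  assumes "j < d"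
  shows "family_det d (a(j := v)) = (\<Sum>l<d. v l * family_cofactor d a j l)"
proof -
  let ?M = "mat d d (\<lambda>(i, l). (a(j := v)) i l)"
  have "mat_delete ?M j l = mat_delete (mat d d (\<lambda>(i, l). a i l)) j l" for l
    unfolding mat_delete_def by (intro cong_mat) auto
  then have "cofactor ?M j l = family_cofactor d a j l" for l
    by (simp only: cofactor_def family_cofactor_def)
  moreover have "?M $$ (j, l) = v l" if "l < d" for l
    using assms that by simp
  moreover have "family_det d (a(j := v)) = (\<Sum>l<d. ?M $$ (j, l) * cofactor ?M j l)"
    unfolding family_det_def by (rule laplace_expansion_row[OF mat_carrier assms])
  ultimately show ?thesis by simp
qed

text \<open>These are the entries of the adjugate times the matrix, which is the determinant times
  the identity.\<close>

lemma sum_family_cofactor: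
  assumes "l < d" "m < d"
  shows "(\<Sum>j<d. family_cofactor d a j l * a j m) = (if l = m then family_det d a else 0)"
proof -
  let ?A = "mat d d (\<lambda>(j, l). a j l)"
  have A: "?A \<in> carrier_mat d d" by simp
  have "(\<Sum>j<d. family_cofactor d a j l * a j m) = (adj_mat ?A * ?A) $$ (l, m)"
    using assms adj_mat(1)[OF A]
    by (simp add: scalar_prod_def adj_mat_def family_cofactor_def lessThan_atLeast0)
  also have "(adj_mat ?A * ?A) $$ (l, m) = (if l = m then family_det d a else 0)"
    unfolding adj_mat(3)[OF A] using assms by (simp add: family_det_def)
  finally show ?thesis by simp
qed

section \<open>The Hahn-Banach theorem\<close>

locale scalar_normed_space = normed_space +
  assumes field_cases: "K = \<real> \<or> K = (UNIV :: complex set)"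
begin

lemmas K_closed = scalars_closed[OF field_cases]

lemma of_real_K [simp]: "complex_of_real t \<in> K"
  using field_cases by auto

lemma smult_carrier [simp]: "c \<in> K \<Longrightarrow> x \<in> carrier V \<Longrightarrow> c \<odot> x \<in> carrier V"
  using smult_closed[of c x] by simp

lemma smult_add_left: "a \<in> K \<Longrightarrow> b \<in> K \<Longrightarrow> x \<in> carrier V \<Longrightarrow> (a + b) \<odot> x = a \<odot> x \<oplus> b \<odot> x"
  using smult_l_distr[of a b x] by simp

lemma smult_add_right:
  "a \<in> K \<Longrightarrow> x \<in> carrier V \<Longrightarrow> y \<in> carrier V \<Longrightarrow> a \<odot> (x \<oplus> y) = a \<odot> x \<oplus> a \<odot> y"
  using smult_r_distr[of a x y] by simp

lemma smult_smult: "a \<in> K \<Longrightarrow> b \<in> K \<Longrightarrow> x \<in> carrier V \<Longrightarrow> a \<odot> (b \<odot> x) = (a * b) \<odot> x"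
  using smult_assoc1[of a b x] by simp

lemma smult_1 [simp]: "x \<in> carrier V \<Longrightarrow> 1 \<odot> x = x"
  using smult_one[of x] by simp

lemma smult_0_left [simp]: "x \<in> carrier V \<Longrightarrow> 0 \<odot> x = \<zero>"
  using smult_l_null[of x] by simp

lemma smult_minus_1: "x \<in> carrier V \<Longrightarrow> (-1) \<odot> x = \<ominus> x"
  using smult_l_minus[of 1 x] smult_one[of x] K_closed
  by (metis M.minus_equality add.left_inverse smult_1 smult_0_left smult_add_left smult_carrier)

lemma norm_zero [simp]: "N \<zero> = 0"
  using norm_eq_0_iff[of \<zero>] by simp

text \<open>Homogeneity concerns nonnegative real factors even over the complex field, because the
  functional is first built as a real one. The factor \<open>0\<close> gives
  \<open>p \<zero> = 0\<close>.\<close>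

definition sublinear :: "('a \<Rightarrow> real) \<Rightarrow> bool" where
  "sublinear p \<longleftrightarrow> (\<forall>x\<in>carrier V. \<forall>y\<in>carrier V. p (x \<oplus> y) \<le> p x + p y) \<and>
     (\<forall>t\<ge>0. \<forall>x\<in>carrier V. p (complex_of_real t \<odot> x) = t * p x)"

text \<open>
  A cone \<open>S\<close> of pairs \<open>(s, t)\<close> with \<open>t \<le> p s\<close> encodes lower bounds \<open>f s \<ge> t\<close> prescribed for a linear
  functional \<open>f \<le> p\<close>: a ray gives norming functionals, the graph of a functional gives extensions.
\<close>

definition minorant_cone :: "('a \<Rightarrow> real) \<Rightarrow> ('a \<times> real) set \<Rightarrow> bool" where
  "minorant_cone p S \<longleftrightarrow> (\<zero>, 0) \<in> S \<and>
     (\<forall>s t. (s, t) \<in> S \<longrightarrow> s \<in> carrier V \<and> t \<le> p s) \<and>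
     (\<forall>s t s' t'. (s, t) \<in> S \<longrightarrow> (s', t') \<in> S \<longrightarrow> (s \<oplus> s', t + t') \<in> S) \<and>
     (\<forall>s t u. (s, t) \<in> S \<longrightarrow> 0 \<le> u \<longrightarrow> (complex_of_real u \<odot> s, u * t) \<in> S)"

lemma sublinear_norm: "sublinear N"
  unfolding sublinear_def using norm_triangle norm_smult by auto

lemma sublinear_add: "sublinear p \<Longrightarrow> x \<in> carrier V \<Longrightarrow> y \<in> carrier V \<Longrightarrow> p (x \<oplus> y) \<le> p x + p y"
  and sublinear_smult: "sublinear p \<Longrightarrow> 0 \<le> t \<Longrightarrow> x \<in> carrier V \<Longrightarrow>
    p (complex_of_real t \<odot> x) = t * p x"
  by (simp_all add: sublinear_def)

lemma sublinear_zero: "sublinear p \<Longrightarrow> p \<zero> = 0"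
  using sublinear_smult[of p 0 \<zero>] by simp

text \<open>Subadditivity applied to \<open>\<ominus> x\<close> and \<open>x \<oplus> s\<close>,
  whose sum is \<open>s\<close>. It bounds the infimum in \<open>sublinear_minorant\<close> from
  below.\<close>

lemma sublinear_lower:
  assumes "sublinear p" "x \<in> carrier V" "s \<in> carrier V"
  shows "p s - p (\<ominus> x) \<le> p (x \<oplus> s)"
proof -
  have "\<ominus> x \<oplus> (x \<oplus> s) = s" using assms by (simp add: M.r_neg1)
  then show ?thesis using sublinear_add[OF assms(1), of "\<ominus> x" "x \<oplus> s"] assms by simp
qed

lemma minorant_cone_ray:
  assumes p: "sublinear p" and y: "y \<in> carrier V" and c: "c \<le> p y"
  shows "minorant_cone p {(complex_of_real t \<odot> y, t * c) | t. t \<ge> 0}" (is "minorant_cone p ?R")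
proof -
  have I: "(complex_of_real t \<odot> y, t * c) \<in> ?R" if "0 \<le> t" for t
    using that by blast
  have "(\<zero>, 0) \<in> ?R" using I[of 0] y by simp
  moreover have "complex_of_real t \<odot> y \<in> carrier V \<and> t * c \<le> p (complex_of_real t \<odot> y)"
    if "0 \<le> t" for t
    using that y c sublinear_smult[OF p that y] by (simp add: mult_left_mono)
  moreover have "(complex_of_real t \<odot> y \<oplus> complex_of_real t' \<odot> y, t * c + t' * c) \<in> ?R"
    if "0 \<le> t" "0 \<le> t'" for t t'
    using I[of "t + t'"] that y by (simp add: smult_add_left distrib_right)
  moreover have "(complex_of_real u \<odot> (complex_of_real t \<odot> y), u * (t * c)) \<in> ?R"
    if "0 \<le> t" "0 \<le> u" for t u
    using I[of "u * t"] that y by (simp add: smult_smult mult.assoc)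
  ultimately show ?thesis
    unfolding minorant_cone_def by blast
qed

text \<open>The infimum of \<open>p (x \<oplus> s) - t\<close> over the cone is again sublinear, as
  the cone is closed under sums and nonnegative multiples. At \<open>\<ominus> s\<close> the pair
  \<open>(s, t)\<close> itself contributes \<open>p \<zero> - t = - t\<close>, which encodes the
  prescribed bound.\<close>

lemma sublinear_minorant:
  assumes p: "sublinear p" and S: "minorant_cone p S"
  obtains q where "sublinear q" "\<And>x. x \<in> carrier V \<Longrightarrow> q x \<le> p x"
    "\<And>s t. (s, t) \<in> S \<Longrightarrow> q (\<ominus> s) \<le> - t"
proof -
  have S0: "(\<zero>, 0) \<in> S"
    using S unfolding minorant_cone_def by blast
  have S1: "s \<in> carrier V" "t \<le> p s" if "(s, t) \<in> S" for s t
    using S that unfolding minorant_cone_def by blast+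
  have S2: "(s \<oplus> s', t + t') \<in> S" if "(s, t) \<in> S" "(s', t') \<in> S" for s t s' t'
    using S that unfolding minorant_cone_def by blast
  have S3: "(complex_of_real u \<odot> s, u * t) \<in> S" if "(s, t) \<in> S" "0 \<le> u" for s t u
    using S that unfolding minorant_cone_def by blast
  \<comment> \<open>bounded below by \<open>- p (\<ominus> x)\<close>, since \<open>t \<le> p s \<le> p (x \<oplus> s) + p (\<ominus> x)\<close>\<close>
  define q where "q x = (INF (s, t)\<in>S. p (x \<oplus> s) - t)" for x
  have bdd: "bdd_below ((\<lambda>(s, t). p (x \<oplus> s) - t) ` S)" if "x \<in> carrier V" for x
  proof (rule bdd_belowI2)
    fix st assume "st \<in> S"
    then show "- p (\<ominus> x) \<le> (case st of (s, t) \<Rightarrow> p (x \<oplus> s) - t)"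
      using S1[of "fst st" "snd st"] sublinear_lower[OF p that, of "fst st"] by (cases st) auto
  qed
  have q_le: "q x \<le> p (x \<oplus> s) - t" if "x \<in> carrier V" "(s, t) \<in> S" for x s t
    unfolding q_def using cINF_lower[OF bdd[OF that(1)] that(2)] by simp
  have q_ge: "c \<le> q x" if "\<And>s t. (s, t) \<in> S \<Longrightarrow> c \<le> p (x \<oplus> s) - t" for c x
    unfolding q_def using S0 that by (intro cINF_greatest) auto
  have sub: "q (x \<oplus> y) \<le> q x + q y" if xy: "x \<in> carrier V" "y \<in> carrier V" for x y
  proof -
    \<comment> \<open>The two infima are taken one after the other: first over \<open>(s, t)\<close>
      with \<open>(s', t')\<close> fixed, then over \<open>(s', t')\<close>.\<close>
    have "q (x \<oplus> y) - (p (y \<oplus> s') - t') \<le> p (x \<oplus> s) - t"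
      if *: "(s, t) \<in> S" "(s', t') \<in> S" for s t s' t'
    proof -
      have "(x \<oplus> y) \<oplus> (s \<oplus> s') = (x \<oplus> s) \<oplus> (y \<oplus> s')"
        using xy S1 * by (simp add: M.a_ac)
      then have "p ((x \<oplus> y) \<oplus> (s \<oplus> s')) \<le> p (x \<oplus> s) + p (y \<oplus> s')"
        using sublinear_add[OF p, of "x \<oplus> s" "y \<oplus> s'"] xy S1 * by simp
      then show ?thesis
        using q_le[of "x \<oplus> y", OF _ S2[OF *]] xy by simp
    qed
    then have "q (x \<oplus> y) - (p (y \<oplus> s') - t') \<le> q x" if "(s', t') \<in> S" for s' t'
      using that by (intro q_ge)
    then have "q (x \<oplus> y) - q x \<le> q y" by (intro q_ge) fastforce
    then show ?thesis by simp
  qed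
  have le: "q (complex_of_real u \<odot> x) \<le> u * q x" if "u > 0" "x \<in> carrier V" for u x
  proof -
    have "q (complex_of_real u \<odot> x) / u \<le> p (x \<oplus> s) - t" if st: "(s, t) \<in> S" for s t
    proof -
      have "p (complex_of_real u \<odot> x \<oplus> complex_of_real u \<odot> s) = u * p (x \<oplus> s)"
        using smult_add_right[of "complex_of_real u" x s] sublinear_smult[OF p, of u "x \<oplus> s"]
          that(1) S1[OF st] \<open>u > 0\<close> \<open>x \<in> carrier V\<close> by simp
      then have "q (complex_of_real u \<odot> x) \<le> u * p (x \<oplus> s) - u * t"
        using q_le[OF _ S3[OF st], of "complex_of_real u \<odot> x" u] \<open>u > 0\<close> \<open>x \<in> carrier V\<close> by simp
      then show ?thesis using \<open>u > 0\<close> by (simp add: field_simps)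
    qed
    then have "q (complex_of_real u \<odot> x) / u \<le> q x" by (rule q_ge)
    then show ?thesis using \<open>u > 0\<close> by (simp add: field_simps)
  qed
  have q0: "q \<zero> = 0"
  proof (rule antisym)
    show "q \<zero> \<le> 0" using q_le[OF _ S0, of \<zero>] sublinear_zero[OF p] by simp
    show "0 \<le> q \<zero>" using S1 by (intro q_ge) simp
  qed
  have hom: "q (complex_of_real u \<odot> x) = u * q x" if "0 \<le> u" "x \<in> carrier V" for u x
  proof (cases "u = 0")
    case False
    then have u: "u > 0" using that by simp
    \<comment> \<open>The reverse inequality is \<open>le\<close> for the factor
      \<open>inverse u\<close> at the scaled vector.\<close>
    have "complex_of_real (inverse u) \<odot> (complex_of_real u \<odot> x) = x"
      using that u by (subst smult_smult) (simp_all add: K_closed flip: of_real_mult)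
    then have "q x \<le> inverse u * q (complex_of_real u \<odot> x)"
      using le[of "inverse u" "complex_of_real u \<odot> x"] u that by simp
    then show ?thesis using le[OF u that(2)] u by (simp add: field_simps)
  qed (use q0 that in simp)
  show ?thesis
  proof (rule that)
    show "sublinear q" using sub hom by (simp add: sublinear_def)
    show "q x \<le> p x" if "x \<in> carrier V" for x
      using q_le[OF that S0] that by simp
    show "q (\<ominus> s) \<le> - t" if "(s, t) \<in> S" for s t
      using q_le[OF _ that, of "\<ominus> s"] S1[OF that] sublinear_zero[OF p] by (simp add: M.l_neg)
  qed
qed

text \<open>Zorn's lemma for the sublinear functionals below \<open>p\<close>; the pointwise infimum
  of a chain is its lower bound.\<close>

lemma minimal_sublinear_exists:
  assumes p: "sublinear p"
  obtains q where "sublinear q" "\<And>x. x \<in> carrier V \<Longrightarrow> q x \<le> p x"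
    "\<And>g x. sublinear g \<Longrightarrow> (\<And>x. x \<in> carrier V \<Longrightarrow> g x \<le> q x) \<Longrightarrow> x \<in> carrier V \<Longrightarrow> g x = q x"
proof -
  \<comment> \<open>The fixed value \<open>0\<close> off the carrier makes the order on
    \<open>Q\<close> antisymmetric.\<close>
  define Q where "Q = {q. sublinear q \<and> (\<forall>x\<in>carrier V. q x \<le> p x) \<and> (\<forall>x. x \<notin> carrier V \<longrightarrow> q x = 0)}"
  \<comment> \<open>The order is reversed, so that a maximal element in Zorn's lemma is a minimal
    functional.\<close>
  define P where "P q g \<longleftrightarrow> (\<forall>x\<in>carrier V. g x \<le> q x)" for q g :: "'a \<Rightarrow> real"
  have restr: "(\<lambda>x. if x \<in> carrier V then g x else 0) \<in> Q"
    if "sublinear g" "\<And>x. x \<in> carrier V \<Longrightarrow> g x \<le> p x" for g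
    using that by (auto simp: Q_def sublinear_def)
  have "partial_order_on Q (relation_of P Q)"
  proof (rule partial_order_on_relation_ofI)
    show "a = b" if "a \<in> Q" "b \<in> Q" "P a b" "P b a" for a b
    proof (rule ext)
      fix x show "a x = b x"
        using that unfolding P_def Q_def by (cases "x \<in> carrier V") (simp_all add: antisym)
    qed
  qed (auto simp: P_def intro: order_trans)
  moreover have "\<exists>u\<in>Q. \<forall>a\<in>C. P a u" if C: "C \<in> Chains (relation_of P Q)" for C
  proof (cases "C = {}")
    case True
    then show ?thesis using restr[OF p] by auto
  next
    case False
    have tot: "P a b \<or> P b a" if "a \<in> C" "b \<in> C" for a b
      using C that by (auto simp: Chains_def relation_of_def)
    have CQ: "sublinear a" "x \<in> carrier V \<Longrightarrow> a x \<le> p x" if "a \<in> C" for a x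
      using C that by (auto simp: Chains_def relation_of_def Q_def)
    define u where "u x = (INF a\<in>C. a x)" for x
    have bdd: "bdd_below ((\<lambda>a. a x) ` C)" if x: "x \<in> carrier V" for x
    proof (rule bdd_belowI2)
      fix a assume a: "a \<in> C"
      have "a \<zero> \<le> a x + a (\<ominus> x)"
        using sublinear_add[OF CQ(1)[OF a] x, of "\<ominus> x"] x by (simp add: M.r_neg)
      moreover have "a (\<ominus> x) \<le> p (\<ominus> x)" using CQ(2)[OF a] x by simp
      ultimately show "- p (\<ominus> x) \<le> a x" using sublinear_zero[OF CQ(1)[OF a]] by simp
    qed
    have u_le: "u x \<le> a x" if "x \<in> carrier V" "a \<in> C" for x a
      unfolding u_def using cINF_lower[OF bdd[OF that(1)] that(2)] by simp
    have u_ge: "c \<le> u x" if "\<And>a. a \<in> C \<Longrightarrow> c \<le> a x" for c x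
      unfolding u_def using False that by (intro cINF_greatest)
    have "sublinear u"
      unfolding sublinear_def
    proof (intro conjI ballI allI impI)
      fix x y assume xy: "x \<in> carrier V" "y \<in> carrier V"
      have "u (x \<oplus> y) - b y \<le> a x" if ab: "a \<in> C" "b \<in> C" for a b
      proof -
        \<comment> \<open>Of two members of a chain one lies below the other, so a single
          \<open>c\<close> serves both \<open>a\<close> and \<open>b\<close>.\<close>
        obtain c where c: "c \<in> C" "P a c" "P b c"
          using tot[OF ab] ab unfolding P_def by blast
        have "u (x \<oplus> y) \<le> c x + c y"
          using u_le[of "x \<oplus> y" c] sublinear_add[OF CQ(1)[OF c(1)] xy] xy c(1) by simp
        then show ?thesis using c(2,3) xy unfolding P_def by fastforce
      qed
      then have "u (x \<oplus> y) - b y \<le> u x" if "b \<in> C" for b using that by (intro u_ge)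
      then have "u (x \<oplus> y) - u x \<le> u y" by (intro u_ge) fastforce
      then show "u (x \<oplus> y) \<le> u x + u y" by simp
    next
      fix t :: real and x assume t: "0 \<le> t" and x: "x \<in> carrier V"
      show "u (complex_of_real t \<odot> x) = t * u x"
      proof (rule antisym)
        have *: "a (complex_of_real t \<odot> x) = t * a x" if "a \<in> C" for a
          by (rule sublinear_smult[OF CQ(1)[OF that] t x])
        show "t * u x \<le> u (complex_of_real t \<odot> x)"
          using u_le[OF x] t by (intro u_ge) (simp add: * mult_left_mono)
        have "u (complex_of_real t \<odot> x) \<le> t * u x" if "t > 0"
        proof -
          have "u (complex_of_real t \<odot> x) / t \<le> a x" if "a \<in> C" for a
            using u_le[OF _ that, of "complex_of_real t \<odot> x"] x *[OF that] \<open>t > 0\<close>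
            by (simp add: field_simps)
          then have "u (complex_of_real t \<odot> x) / t \<le> u x" by (rule u_ge)
          then show ?thesis using that by (simp add: field_simps)
        qed
        moreover have "u \<zero> \<le> 0"
          using False u_le[of \<zero>] sublinear_zero[OF CQ(1)] by fastforce
        ultimately show "u (complex_of_real t \<odot> x) \<le> t * u x"
          using t x by (cases "t = 0") auto
      qed
    qed
    moreover have "u x \<le> p x" if "x \<in> carrier V" for x
    proof -
      obtain a where "a \<in> C" using False by blast
      then show ?thesis using u_le[OF that] CQ(2)[OF _ that] by fastforce
    qed
    ultimately have "(\<lambda>x. if x \<in> carrier V then u x else 0) \<in> Q" by (rule restr)
    then show ?thesis
      using u_le by (auto simp: P_def intro!: bexI[of _ "\<lambda>x. if x \<in> carrier V then u x else 0"])
  qed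
  ultimately obtain q where q: "q \<in> Q" "\<And>a. a \<in> Q \<Longrightarrow> P q a \<Longrightarrow> a = q"
    using predicate_Zorn[of Q P] by blast
  show ?thesis
  proof (rule that)
    show "sublinear q" "\<And>x. x \<in> carrier V \<Longrightarrow> q x \<le> p x" using q(1) by (auto simp: Q_def)
    fix g x assume g: "sublinear g" "\<And>x. x \<in> carrier V \<Longrightarrow> g x \<le> q x" "x \<in> carrier V"
    then have "(\<lambda>x. if x \<in> carrier V then g x else 0) \<in> Q"
      using q(1) by (intro restr) (auto simp: Q_def intro: order_trans)
    moreover have "P q (\<lambda>x. if x \<in> carrier V then g x else 0)" using g(2) by (simp add: P_def)
    ultimately have "(\<lambda>x. if x \<in> carrier V then g x else 0) = q" by (rule q(2))
    from fun_cong[OF this, of x] show "g x = q x" using g(3) by simp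
  qed
qed

text \<open>A minimal sublinear functional is additive, and with positive homogeneity this makes it
  real linear. The cone is built into \<open>p0\<close> beforehand:
  \<open>f (\<ominus> s) \<le> p0 (\<ominus> s) \<le> - t\<close> turns into
  \<open>t \<le> f s\<close> by linearity.\<close>

lemma real_hahn_banach:
  assumes p: "sublinear p" and S: "minorant_cone p S"
  obtains f where "\<And>x y. x \<in> carrier V \<Longrightarrow> y \<in> carrier V \<Longrightarrow> f (x \<oplus> y) = f x + f y"
    "\<And>t x. x \<in> carrier V \<Longrightarrow> f (complex_of_real t \<odot> x) = t * f x"
    "\<And>x. x \<in> carrier V \<Longrightarrow> f x \<le> p x" "\<And>s t. (s, t) \<in> S \<Longrightarrow> t \<le> f s"
proof -
  obtain p0 where p0: "sublinear p0" "\<And>x. x \<in> carrier V \<Longrightarrow> p0 x \<le> p x"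
    "\<And>s t. (s, t) \<in> S \<Longrightarrow> p0 (\<ominus> s) \<le> - t"
    using sublinear_minorant[OF p S] by blast
  obtain f where f: "sublinear f" "\<And>x. x \<in> carrier V \<Longrightarrow> f x \<le> p0 x"
    and min: "\<And>g x. sublinear g \<Longrightarrow> (\<And>x. x \<in> carrier V \<Longrightarrow> g x \<le> f x) \<Longrightarrow> x \<in> carrier V \<Longrightarrow> g x = f x"
    using minimal_sublinear_exists[OF p0(1)] by blast
  \<comment> \<open>minimality of \<open>f\<close> against the minorant built from the ray through \<open>y\<close>\<close>
  have add: "f (x \<oplus> y) = f x + f y" if xy: "x \<in> carrier V" "y \<in> carrier V" for x y
  proof -
    define R where "R = {(complex_of_real t \<odot> y, t * f y) | t. t \<ge> 0}"
    have "minorant_cone f R"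
      unfolding R_def by (rule minorant_cone_ray[OF f(1) xy(2) order_refl])
    then obtain g where g: "sublinear g" "\<And>x. x \<in> carrier V \<Longrightarrow> g x \<le> f x"
      "\<And>s t. (s, t) \<in> R \<Longrightarrow> g (\<ominus> s) \<le> - t"
      using sublinear_minorant[OF f(1)] by blast
    have "(y, f y) \<in> R" unfolding R_def using xy by (auto intro!: exI[of _ 1])
    from g(3)[OF this] have "f (\<ominus> y) \<le> - f y"
      using min[OF g(1,2)] xy by simp
    moreover have "x = (x \<oplus> y) \<oplus> \<ominus> y" using xy by (simp add: M.a_assoc M.r_neg)
    then have "f x \<le> f (x \<oplus> y) + f (\<ominus> y)"
      using sublinear_add[OF f(1), of "x \<oplus> y" "\<ominus> y"] xy by simp
    ultimately show ?thesis using sublinear_add[OF f(1) xy] by simp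
  qed
  have neg: "f (\<ominus> x) = - f x" if "x \<in> carrier V" for x
    using add[of x "\<ominus> x"] that sublinear_zero[OF f(1)] by (simp add: M.r_neg)
  show ?thesis
  proof (rule that)
    show "f (complex_of_real t \<odot> x) = t * f x" if x: "x \<in> carrier V" for t x
    proof (cases "t \<ge> 0")
      case False
      let ?y = "complex_of_real (- t) \<odot> x"
      have y: "?y \<in> carrier V" using x by (intro smult_carrier of_real_K)
      have ty: "complex_of_real t \<odot> x = \<ominus> ?y"
        using x y K_closed by (subst smult_minus_1[symmetric]) (simp_all add: smult_smult)
      have "f ?y = - t * f x" using sublinear_smult[OF f(1), of "- t" x] False x by simp
      then show ?thesis unfolding ty neg[OF y] by simp
    qed (use sublinear_smult[OF f(1)] x in simp)
    show "t \<le> f s" if "(s, t) \<in> S" for s t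
    proof -
      have s: "s \<in> carrier V" using S that by (auto simp: minorant_cone_def)
      then show ?thesis
        using p0(3)[OF that] f(2)[of "\<ominus> s"] neg[OF s] by simp
    qed
  qed (use add f(2) p0(2) order_trans in blast)+
qed

section \<open>Scalar-linear functionals and the dual unit ball\<close>

abbreviation linear_functional :: "('a \<Rightarrow> complex) \<Rightarrow> bool" where
  "linear_functional \<equiv> linear_map K V (scalars K)"

text \<open>The closed unit ball of the dual space, stated by a pointwise bound so that no supremum
  has to be evaluated; \<open>functional_norm_dual_ball\<close> makes the link to
  \<open>functional_norm\<close>.\<close>

definition dual_ball :: "('a \<Rightarrow> complex) set" where
  "dual_ball = {h. linear_functional h \<and> (\<forall>x\<in>carrier V. cmod (h x) \<le> N x)}"

lemma linear_functional_add:
    "linear_functional h \<Longrightarrow> x \<in> carrier V \<Longrightarrow> y \<in> carrier V \<Longrightarrow> h (x \<oplus> y) = h x + h y"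
  and linear_functional_smult:
    "linear_functional h \<Longrightarrow> c \<in> K \<Longrightarrow> x \<in> carrier V \<Longrightarrow> h (c \<odot> x) = c * h x"
  and linear_functional_K: "linear_functional h \<Longrightarrow> x \<in> carrier V \<Longrightarrow> h x \<in> K"
  by (auto simp: linear_map_def)

lemma linear_functional_zero: "linear_functional h \<Longrightarrow> h \<zero> = 0"
  using linear_functional_smult[of h 0 \<zero>] K_closed by simp

text \<open>Over the reals the functional of \<open>real_hahn_banach\<close> already works; over the
  complex numbers it becomes the real part of a complex linear functional.\<close>

lemma hahn_banach:
  assumes S: "minorant_cone N S"
  obtains F where "F \<in> dual_ball" "\<And>s t. (s, t) \<in> S \<Longrightarrow> t \<le> Re (F s)"
proof -
  obtain f where add: "\<And>x y. x \<in> carrier V \<Longrightarrow> y \<in> carrier V \<Longrightarrow> f (x \<oplus> y) = f x + f y"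
    and smult: "\<And>t x. x \<in> carrier V \<Longrightarrow> f (complex_of_real t \<odot> x) = t * f x"
    and le: "\<And>x. x \<in> carrier V \<Longrightarrow> f x \<le> N x" and S: "\<And>s t. (s, t) \<in> S \<Longrightarrow> t \<le> f s"
    by (rule real_hahn_banach[OF sublinear_norm S]) (rule that)
  consider "K = \<real>" | "K = UNIV" using field_cases by blast
  then show ?thesis
  proof cases
    case 1
    have "\<bar>f x\<bar> \<le> N x" if x: "x \<in> carrier V" for x
    proof -
      have "complex_of_real (-1) \<odot> x \<in> carrier V" using x by (intro smult_carrier of_real_K)
      from le[OF this] have "- f x \<le> N x"
        unfolding smult[OF x] norm_smult[OF of_real_K x] by simp
      then show ?thesis using le[OF x] by simp
    qed
    moreover have "linear_functional (\<lambda>x. complex_of_real (f x))"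
      using 1 by (auto simp: linear_map_def add smult elim!: Reals_cases)
    ultimately show ?thesis
      using S by (intro that[of "\<lambda>x. complex_of_real (f x)"]) (auto simp: dual_ball_def)
  next
    case 2
    \<comment> \<open>The only complex linear functional with real part \<open>f\<close>, since the
      imaginary part of \<open>F x\<close> must be minus the real part of
      \<open>F (\<i> \<odot> x)\<close>.\<close>
    define F where "F x = Complex (f x) (- f (\<i> \<odot> x))" for x
    have smc: "c \<odot> x \<in> carrier V" if "x \<in> carrier V" for c x
      using that 2 by simp
    \<comment> \<open>Used for \<open>c\<close> and for \<open>\<i> * c\<close>, this gives the real
      and the imaginary part of \<open>F (c \<odot> x) = c * F x\<close>.\<close>
    have split: "f (c \<odot> x) = Re c * f x + Im c * f (\<i> \<odot> x)" if x: "x \<in> carrier V" for c x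
    proof -
      have "c = complex_of_real (Re c) + complex_of_real (Im c) * \<i>"
        by (simp add: complex_eq_iff)
      then have "c \<odot> x = (complex_of_real (Re c) + complex_of_real (Im c) * \<i>) \<odot> x" by simp
      also have "\<dots> = complex_of_real (Re c) \<odot> x \<oplus> complex_of_real (Im c) \<odot> (\<i> \<odot> x)"
        using x 2 by (simp add: smult_add_left smult_smult)
      finally have "c \<odot> x = complex_of_real (Re c) \<odot> x \<oplus> complex_of_real (Im c) \<odot> (\<i> \<odot> x)" .
      then show ?thesis using x smc by (simp add: add smult)
    qed
    have "F (c \<odot> x) = c * F x" if x: "x \<in> carrier V" for c x
      using split[OF x, of c] split[OF x, of "\<i> * c"] x 2
      by (simp add: F_def smult_smult complex_eq_iff)
    moreover have "F (x \<oplus> y) = F x + F y" if "x \<in> carrier V" "y \<in> carrier V" for x y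
      using that 2 by (simp add: F_def add smult_add_right smc complex_eq_iff)
    ultimately have lin: "linear_functional F"
      using 2 by (simp add: linear_map_def)
    have "cmod (F x) \<le> N x" if x: "x \<in> carrier V" for x
    proof (cases "F x = 0")
      case False
      \<comment> \<open>A unimodular factor turning \<open>F x\<close> into its modulus, so that the
        bound on the real part \<open>f\<close> at \<open>c \<odot> x\<close> bounds
        \<open>cmod (F x)\<close>.\<close>
      define c where "c = cnj (F x) / cmod (F x)"
      have c: "cmod c = 1" using False by (simp add: c_def norm_divide)
      have "F (c \<odot> x) = c * F x"
        using linear_functional_smult[OF lin _ x, of c] 2 by simp
      also have "\<dots> = cmod (F x)"
        unfolding c_def using False complex_norm_square[of "F x"]
        by (simp add: mult.commute[of _ "F x"] power2_eq_square divide_eq_eq)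
      finally have "f (c \<odot> x) = cmod (F x)" by (simp add: F_def complex_eq_iff)
      then show ?thesis using le[OF smc[OF x], of c] norm_smult[OF _ x, of c] 2 c by simp
    qed (use norm_nonneg x in simp)
    then show ?thesis
      using S lin by (intro that[of F]) (auto simp: dual_ball_def F_def)
  qed
qed

text \<open>Hahn-Banach for the ray through \<open>y\<close>, with the norm itself as prescribed
  lower bound at \<open>y\<close>.\<close>

lemma norming_functional:
  assumes "y \<in> carrier V"
  obtains F where "F \<in> dual_ball" "N y \<le> cmod (F y)"
proof -
  obtain F where F: "F \<in> dual_ball"
    "\<And>s t. (s, t) \<in> {(complex_of_real t \<odot> y, t * N y) | t. t \<ge> 0} \<Longrightarrow> t \<le> Re (F s)"
    using hahn_banach[OF minorant_cone_ray[OF sublinear_norm assms order_refl]] by blast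
  have "(complex_of_real 1 \<odot> y, 1 * N y) \<in> {(complex_of_real t \<odot> y, t * N y) | t. t \<ge> 0}"
    by (intro CollectI exI[of _ 1]) simp
  from F(2)[OF this] have "N y \<le> cmod (F y)"
    using complex_Re_le_cmod[of "F y"] assms by simp
  with F(1) show ?thesis by (rule that)
qed

text \<open>The graph of \<open>Re g\<close> over the subspace \<open>M\<close> is a minorant cone.
  Its lower bounds at \<open>x\<close> and at \<open>(-1) \<odot> x\<close> force equal real parts,
  and over the complex field multiplication by \<open>\<i>\<close> settles the imaginary
  parts.\<close>

lemma dual_ball_extension:
  assumes M: "M \<subseteq> carrier V" "\<zero> \<in> M" "\<And>x y. x \<in> M \<Longrightarrow> y \<in> M \<Longrightarrow> x \<oplus> y \<in> M"
      "\<And>c x. c \<in> K \<Longrightarrow> x \<in> M \<Longrightarrow> c \<odot> x \<in> M"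
    and g: "\<And>x. x \<in> M \<Longrightarrow> g x \<in> K" "\<And>x y. x \<in> M \<Longrightarrow> y \<in> M \<Longrightarrow> g (x \<oplus> y) = g x + g y"
      "\<And>c x. c \<in> K \<Longrightarrow> x \<in> M \<Longrightarrow> g (c \<odot> x) = c * g x" "\<And>x. x \<in> M \<Longrightarrow> cmod (g x) \<le> N x"
  obtains G where "G \<in> dual_ball" "\<And>x. x \<in> M \<Longrightarrow> G x = g x"
proof -
  define S where "S = {(x, Re (g x)) | x. x \<in> M}"
  have SI: "(x, Re (g x)) \<in> S" if "x \<in> M" for x using that by (auto simp: S_def)
  have "minorant_cone N S"
    unfolding minorant_cone_def
  proof (intro conjI allI impI)
    have "g \<zero> = 0" using g(3)[of 0 \<zero>] M(2) K_closed by simp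
    then show "(\<zero>, 0) \<in> S" using SI[OF M(2)] by simp
  next
    fix s t assume "(s, t) \<in> S"
    then have s: "s \<in> M" "t = Re (g s)" by (auto simp: S_def)
    show "s \<in> carrier V" using s M(1) by auto
    show "t \<le> N s" using s g(4)[OF s(1)] complex_Re_le_cmod[of "g s"] by simp
    show "(complex_of_real u \<odot> s, u * t) \<in> S" for u
      using SI[OF M(4)[OF of_real_K s(1)], of u] g(3)[OF of_real_K s(1)] s(2) by simp
    fix s' t' assume "(s', t') \<in> S"
    then show "(s \<oplus> s', t + t') \<in> S"
      using s SI[OF M(3)[OF s(1)], of s'] g(2)[OF s(1), of s'] by (auto simp: S_def)
  qed
  then obtain G where G: "G \<in> dual_ball" "\<And>s t. (s, t) \<in> S \<Longrightarrow> t \<le> Re (G s)"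
    using hahn_banach by blast
  have lin: "linear_functional G" using G(1) by (simp add: dual_ball_def)
  have Re: "Re (G x) = Re (g x)" if x: "x \<in> M" for x
  proof -
    have m1: "-1 \<in> K" using K_closed by simp
    have "x \<in> carrier V" using M(1) x by auto
    have "Re (g ((-1) \<odot> x)) \<le> Re (G ((-1) \<odot> x))" by (rule G(2)[OF SI[OF M(4)[OF m1 x]]])
    then show ?thesis
      using G(2)[OF SI[OF x]] g(3)[OF m1 x] linear_functional_smult[OF lin m1 \<open>x \<in> carrier V\<close>]
      by simp
  qed
  have "G x = g x" if x: "x \<in> M" for x
  proof -
    have xV: "x \<in> carrier V" using M(1) x by auto
    consider "K = \<real>" | "K = UNIV" using field_cases by blast
    then have "Im (G x) = Im (g x)"
    proof cases
      case 1
      then show ?thesis using g(1)[OF x] linear_functional_K[OF lin xV] by (simp add: complex_is_Real_iff)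
    next
      case 2
      then have "\<i> \<in> K" by simp
      then show ?thesis
        using Re[OF M(4)[OF _ x], of \<i>] g(3)[OF _ x, of \<i>] linear_functional_smult[OF lin _ xV, of \<i>]
        by simp
    qed
    then show ?thesis using Re[OF x] by (simp add: complex_eq_iff)
  qed
  with G(1) show ?thesis by (rule that)
qed

section \<open>Bounded functionals and finite linear combinations\<close>

lemma dual_ball_bounded_functional: "h \<in> dual_ball \<Longrightarrow> bounded_functional K V N h"
  unfolding dual_ball_def bounded_functional_def by (auto intro: exI[of _ 1])

lemma bounded_functional_add:
  assumes "bounded_functional K V N f" "bounded_functional K V N g"
  shows "bounded_functional K V N (\<lambda>x. f x + g x)"
proof -
  obtain A B where "\<forall>x\<in>carrier V. cmod (f x) \<le> A * N x" "\<forall>x\<in>carrier V. cmod (g x) \<le> B * N x"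
    using assms unfolding bounded_functional_def by blast
  then have "\<forall>x\<in>carrier V. cmod (f x + g x) \<le> (A + B) * N x"
    by (auto simp: distrib_right intro!: norm_triangle_le add_mono)
  moreover have "linear_functional (\<lambda>x. f x + g x)"
    using assms K_closed unfolding bounded_functional_def linear_map_def
    by (auto simp: algebra_simps Pi_iff)
  ultimately show ?thesis unfolding bounded_functional_def by blast
qed

lemma bounded_functional_cmult:
  assumes "bounded_functional K V N f" "c \<in> K"
  shows "bounded_functional K V N (\<lambda>x. c * f x)"
proof -
  obtain A where "\<forall>x\<in>carrier V. cmod (f x) \<le> A * N x"
    using assms unfolding bounded_functional_def by blast
  then have "\<forall>x\<in>carrier V. cmod (c * f x) \<le> (cmod c * A) * N x"
    by (auto simp: norm_mult mult.assoc intro!: mult_left_mono)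
  moreover have "linear_functional (\<lambda>x. c * f x)"
    using assms K_closed unfolding bounded_functional_def linear_map_def
    by (auto simp: algebra_simps Pi_iff)
  ultimately show ?thesis unfolding bounded_functional_def by blast
qed

lemma bounded_functional_sum:
  assumes "\<And>l. l < (d::nat) \<Longrightarrow> c l \<in> K" "\<And>l. l < d \<Longrightarrow> bounded_functional K V N (f l)"
  shows "bounded_functional K V N (\<lambda>x. \<Sum>l<d. c l * f l x)"
  using assms
proof (induction d)
  case 0
  then show ?case
    using K_closed norm_nonneg by (auto simp: bounded_functional_def linear_map_def intro!: exI[of _ 1])
next
  case (Suc d)
  then show ?case
    by (simp add: bounded_functional_add bounded_functional_cmult)
qed

text \<open>The linear combination of the \<open>v l\<close> is described by its values under
  functionals, the only form in which it is later substituted into a slot of a tensor.\<close>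

lemma linear_combination_exists:
  assumes "\<And>l. l < (d::nat) \<Longrightarrow> c l \<in> K" "\<And>l. l < d \<Longrightarrow> v l \<in> carrier V"
  shows "\<exists>x\<in>carrier V. \<forall>h. linear_functional h \<longrightarrow> h x = (\<Sum>l<d. c l * h (v l))"
  using assms
proof (induction d)
  case 0
  then show ?case using linear_functional_zero by auto
next
  case (Suc d)
  then obtain x where x: "x \<in> carrier V" "\<And>h. linear_functional h \<Longrightarrow> h x = (\<Sum>l<d. c l * h (v l))"
    by auto
  have cv: "c d \<in> K" "v d \<in> carrier V" using Suc.prems by auto
  show ?case
    using x cv linear_functional_add[OF _ x(1) smult_carrier[OF cv]] linear_functional_smult[OF _ cv]
    by (intro bexI[of _ "x \<oplus> c d \<odot> v d"]) auto
qed

section \<open>Nearly Auerbach bases\<close>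

definition biorthogonal :: "nat \<Rightarrow> (nat \<Rightarrow> 'a) \<Rightarrow> (nat \<Rightarrow> 'a \<Rightarrow> complex) \<Rightarrow> bool" where
  "biorthogonal d b f \<longleftrightarrow> (\<forall>l<d. b l \<in> carrier V \<and> bounded_functional K V N (f l) \<and>
     (\<forall>m<d. f l (b m) = (if l = m then 1 else 0)))"

text \<open>
  Equality of vectors is tested against all linear functionals: slots of multilinear forms are such
  functionals, so expansions in this form can be substituted into elementary tensors directly.
\<close>

definition biorthogonal_span :: "nat \<Rightarrow> (nat \<Rightarrow> 'a) \<Rightarrow> (nat \<Rightarrow> 'a \<Rightarrow> complex) \<Rightarrow> 'a set" where
  "biorthogonal_span d b f =
     {x \<in> carrier V. \<forall>h. linear_functional h \<longrightarrow> h x = (\<Sum>l<d. f l x * h (b l))}"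

lemma biorthogonal_linear: "biorthogonal d b f \<Longrightarrow> l < d \<Longrightarrow> linear_functional (f l)"
  by (simp add: biorthogonal_def bounded_functional_def)

lemma biorthogonal_span_add:
  assumes "biorthogonal d b f" "x \<in> biorthogonal_span d b f" "y \<in> biorthogonal_span d b f"
  shows "x \<oplus> y \<in> biorthogonal_span d b f"
  using assms linear_functional_add[OF biorthogonal_linear[OF assms(1)]]
  by (auto simp: biorthogonal_span_def linear_functional_add distrib_right sum.distrib)

lemma biorthogonal_span_smult:
  assumes "biorthogonal d b f" "x \<in> biorthogonal_span d b f" "c \<in> K"
  shows "c \<odot> x \<in> biorthogonal_span d b f"
  using assms linear_functional_smult[OF biorthogonal_linear[OF assms(1)]]
  by (auto simp: biorthogonal_span_def linear_functional_smult mult.assoc sum_distrib_left)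

lemma biorthogonal_span_basis:
  assumes "biorthogonal d b f" "m < d"
  shows "b m \<in> biorthogonal_span d b f"
proof -
  have "(\<Sum>l<d. f l (b m) * h (b l)) = (\<Sum>l<d. if l = m then h (b m) else 0)" for h
    using assms by (intro sum.cong) (auto simp: biorthogonal_def)
  then show ?thesis using assms by (simp add: biorthogonal_span_def biorthogonal_def)
qed

text \<open>A Gram-Schmidt step with functionals: subtracting from \<open>x\<close> its expansion
  leaves a remainder \<open>y\<close> annihilated by all \<open>f l\<close>. If \<open>y\<close> is
  zero, the old family suffices; otherwise \<open>y\<close> is the new basis vector.\<close>

lemma biorthogonal_extend:
  assumes bf: "biorthogonal d b f" and x: "x \<in> carrier V"
  obtains d' b' f' where "d' \<le> Suc d" "biorthogonal d' b' f'"
    "biorthogonal_span d b f \<subseteq> biorthogonal_span d' b' f'" "x \<in> biorthogonal_span d' b' f'"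
proof -
  have b: "b l \<in> carrier V" and f: "bounded_functional K V N (f l)" if "l < d" for l
    using bf that by (auto simp: biorthogonal_def)
  have fb: "f l (b m) = (if l = m then 1 else 0)" if "l < d" "m < d" for l m
    using bf that by (auto simp: biorthogonal_def)
  have fl: "linear_functional (f l)" if "l < d" for l by (rule biorthogonal_linear[OF bf that])
  obtain v where v: "v \<in> carrier V" "\<And>h. linear_functional h \<Longrightarrow> h v = (\<Sum>l<d. f l x * h (b l))"
    using linear_combination_exists[of d "\<lambda>l. f l x" b] b linear_functional_K[OF fl x] by auto
  have m1: "-1 \<in> K" using K_closed by simp
  define y where "y = x \<oplus> (-1) \<odot> v"
  have y: "y \<in> carrier V" using x v m1 by (simp add: y_def)
  have hy: "h y = h x - (\<Sum>l<d. f l x * h (b l))" if "linear_functional h" for h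
    unfolding y_def using linear_functional_add[OF that x smult_carrier[OF m1 v(1)]]
      linear_functional_smult[OF that m1 v(1)] v(2)[OF that] by simp
  show ?thesis
  proof (cases "y = \<zero>")
    case True
    have "h x = (\<Sum>l<d. f l x * h (b l))" if "linear_functional h" for h
      using hy[OF that] linear_functional_zero[OF that] True by simp
    then have "x \<in> biorthogonal_span d b f" using x by (simp add: biorthogonal_span_def)
    then show ?thesis using bf by (intro that[of d b f]) auto
  next
    case False
    obtain g where g: "g \<in> dual_ball" "N y \<le> cmod (g y)" using norming_functional[OF y] .
    have gl: "linear_functional g" using g by (simp add: dual_ball_def)
    have gy: "g y \<noteq> 0"
      using g(2) False norm_eq_0_iff[OF y] norm_nonneg[OF y] by auto
    have gK: "g z \<in> K" if "z \<in> carrier V" for z by (rule linear_functional_K[OF gl that])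
    \<comment> \<open>The norming functional \<open>g\<close> of \<open>y\<close>, corrected to
      vanish on every \<open>b l\<close> and scaled to take the value \<open>1\<close> at
      \<open>y\<close>.\<close>
    define w where "w z = inverse (g y) * (g z + (\<Sum>l<d. (- g (b l)) * f l z))" for z
    have w: "bounded_functional K V N w"
      unfolding w_def using gK b f y K_closed
      by (intro bounded_functional_cmult bounded_functional_add bounded_functional_sum
          dual_ball_bounded_functional[OF g(1)]) auto
    have wb: "w (b m) = 0" if "m < d" for m
    proof -
      have "(\<Sum>l<d. (- g (b l)) * f l (b m)) = (\<Sum>l<d. if l = m then - g (b m) else 0)"
        using fb that by (intro sum.cong) auto
      then show ?thesis using that by (simp add: w_def)
    qed
    have fy: "f l y = 0" if "l < d" for l
    proof -
      have "(\<Sum>m<d. f m x * f l (b m)) = (\<Sum>m<d. if m = l then f l x else 0)"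
        using fb that by (intro sum.cong) auto
      then show ?thesis using hy[OF fl[OF that]] that by simp
    qed
    have wy: "w y = 1" using fy gy by (simp add: w_def)
    have wz: "w z = (g z - (\<Sum>l<d. f l z * g (b l))) / g y" for z
      by (simp add: w_def field_simps sum_negf)
    have "biorthogonal (Suc d) (b(d := y)) (f(d := w))"
      unfolding biorthogonal_def using b f fb y w wb wy fy by (auto simp: less_Suc_eq)
    moreover have sum: "(\<Sum>l<Suc d. (f(d := w)) l z * h ((b(d := y)) l))
        = (\<Sum>l<d. f l z * h (b l)) + w z * h y" for h z
      by simp
    \<comment> \<open>On the old span \<open>g z\<close> equals its own expansion, so
      \<open>w z = 0\<close> by \<open>wz\<close> and the additional summand drops out.\<close>
    have "biorthogonal_span d b f \<subseteq> biorthogonal_span (Suc d) (b(d := y)) (f(d := w))"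
      unfolding biorthogonal_span_def sum using gl by (auto simp: wz)
    moreover have "x \<in> biorthogonal_span (Suc d) (b(d := y)) (f(d := w))"
    proof -
      have "w x = 1" unfolding wz using hy[OF gl] gy by simp
      moreover have "h x = (\<Sum>l<d. f l x * h (b l)) + h y" if "linear_functional h" for h
        using hy[OF that] by simp
      ultimately show ?thesis unfolding biorthogonal_span_def sum using x by simp
    qed
    ultimately show ?thesis by (intro that[of "Suc d" "b(d := y)" "f(d := w)"]) auto
  qed
qed

text \<open>The vectors are added one at a time. A vector already in the span enlarges nothing,
  hence \<open>d \<le> k\<close> rather than equality.\<close>

lemma biorthogonal_exists:
  assumes "\<And>i. i < (k::nat) \<Longrightarrow> x i \<in> carrier V"
  obtains d b f where "d \<le> k" "biorthogonal d b f" "\<And>i. i < k \<Longrightarrow> x i \<in> biorthogonal_span d b f"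
  using assms
proof (induction k arbitrary: thesis)
  case 0
  show ?case by (rule 0(1)[of 0]) (simp_all add: biorthogonal_def)
next
  case (Suc k)
  obtain d b f where *: "d \<le> k" "biorthogonal d b f" "\<And>i. i < k \<Longrightarrow> x i \<in> biorthogonal_span d b f"
    using Suc.IH Suc.prems(2) by (metis less_Suc_eq)
  have "x k \<in> carrier V" using Suc.prems(2) by simp
  from biorthogonal_extend[OF *(2) this] obtain d' b' f' where "d' \<le> Suc d" "biorthogonal d' b' f'"
    "biorthogonal_span d b f \<subseteq> biorthogonal_span d' b' f'" "x k \<in> biorthogonal_span d' b' f'" .
  then show ?case using * by (intro Suc.prems(1)[of d' b' f']) (auto simp: less_Suc_eq)
qed

text \<open>The given family is only a reference system in which determinants are computed.
  Coordinates bounded by \<open>\<delta>\<close> are divided by \<open>\<delta>\<close> and extended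
  from the span to all of \<open>V\<close> by Hahn-Banach, so \<open>\<delta>\<close> reappears as a
  factor of the expansion.\<close>

lemma near_auerbach_span:
  assumes bf: "biorthogonal d b f" and \<delta>: "1 < (\<delta>::real)"
  obtains e g where "\<And>j. j < d \<Longrightarrow> e j \<in> carrier V" "\<And>j. j < d \<Longrightarrow> N (e j) \<le> 1"
    "\<And>j. j < d \<Longrightarrow> g j \<in> dual_ball"
    "\<And>x h. x \<in> biorthogonal_span d b f \<Longrightarrow> linear_functional h \<Longrightarrow>
       h x = complex_of_real \<delta> * (\<Sum>j<d. g j x * h (e j))"
proof -
  let ?M = "biorthogonal_span d b f"
  have MV: "x \<in> carrier V" if "x \<in> ?M" for x using that by (simp add: biorthogonal_span_def)
  have fl: "linear_functional (f l)" if "l < d" for l by (rule biorthogonal_linear[OF bf that])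
  have b: "b l \<in> carrier V" if "l < d" for l using bf that by (simp add: biorthogonal_def)
  have fb: "f l (b m) = (if l = m then 1 else 0)" if "l < d" "m < d" for l m
    using bf that by (auto simp: biorthogonal_def)
  have "\<forall>l. \<exists>B. l < d \<longrightarrow> (\<forall>x\<in>carrier V. cmod (f l x) \<le> B * N x)"
    using bf unfolding biorthogonal_def bounded_functional_def by blast
  then obtain B where B: "\<And>l x. l < d \<Longrightarrow> x \<in> carrier V \<Longrightarrow> cmod (f l x) \<le> B l * N x"
    by metis
  define C where "C = (\<Sum>l<d. \<bar>B l\<bar>)"
  have C: "cmod (f l x) \<le> C * N x" if "l < d" "x \<in> carrier V" for l x
  proof -
    have "\<bar>B l\<bar> \<le> C" unfolding C_def using that by (intro member_le_sum) auto
    then have "B l * N x \<le> C * N x" using norm_nonneg[OF that(2)] by (intro mult_right_mono) auto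
    then show ?thesis using B[OF that] by simp
  qed
  have C0: "0 \<le> C" by (simp add: C_def sum_nonneg)
  define a where "a e j l = f l (e j)" for e :: "nat \<Rightarrow> 'a" and j l :: nat
  define D where "D e = family_det d (a e)" for e
  \<comment> \<open>By Cramer's rule the coordinates with respect to a family \<open>e\<close> are quotients of determinants, so
    a family nearly maximizing \<open>\<bar>D e\<bar>\<close> has coordinates bounded by \<open>\<delta>\<close> on the unit ball.\<close>
  define E where "E = {e. \<forall>j<d. e j \<in> ?M \<and> N (e j) \<le> 1}"
  have D_le: "cmod (D e) \<le> fact d * C ^ d" if "e \<in> E" for e
    unfolding D_def
  proof (rule cmod_family_det_le)
    fix j l assume "j < d" "l < d"
    then have "e j \<in> carrier V" "N (e j) \<le> 1" using that MV by (auto simp: E_def)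
    then have "C * N (e j) \<le> C * 1" using C0 by (intro mult_left_mono)
    then show "cmod (a e j l) \<le> C"
      using C[OF \<open>l < d\<close> \<open>e j \<in> carrier V\<close>] by (simp add: a_def)
  qed
  \<comment> \<open>If \<open>N x = 0\<close>, the convention \<open>inverse 0 = 0\<close> gives the
    zero vector, which still lies in the unit ball.\<close>
  have normalize: "complex_of_real (inverse (N x)) \<odot> x \<in> ?M"
      "N (complex_of_real (inverse (N x)) \<odot> x) \<le> 1" if "x \<in> ?M" for x
  proof -
    show "complex_of_real (inverse (N x)) \<odot> x \<in> ?M"
      by (rule biorthogonal_span_smult[OF bf that of_real_K])
    show "N (complex_of_real (inverse (N x)) \<odot> x) \<le> 1"
      unfolding norm_smult[OF of_real_K MV[OF that]] using norm_nonneg[OF MV[OF that]]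
      by (cases "N x = 0") (simp_all add: norm_inverse)
  qed
  \<comment> \<open>The normalized reference basis has a diagonal coordinate matrix with nonzero
    diagonal, so the supremum \<open>s\<close> below is positive.\<close>
  define e0 where "e0 j = complex_of_real (inverse (N (b j))) \<odot> b j" for j
  have e0: "e0 \<in> E"
    using normalize biorthogonal_span_basis[OF bf] by (simp add: E_def e0_def)
  have "D e0 \<noteq> 0"
    unfolding D_def
  proof (rule family_det_diag)
    have *: "a e0 j l = complex_of_real (inverse (N (b j))) * (if l = j then 1 else 0)"
      if "j < d" "l < d" for j l
      unfolding a_def e0_def linear_functional_smult[OF fl[OF that(2)] of_real_K b[OF that(1)]]
        fb[OF that(2,1)] by simp
    show "a e0 j l = 0" if "j < d" "l < d" "j \<noteq> l" for j l using * that by simp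
    show "a e0 j j \<noteq> 0" if "j < d" for j
    proof -
      have "b j \<noteq> \<zero>"
        using fb[OF that that] linear_functional_zero[OF fl[OF that]] by auto
      then show ?thesis using * that norm_eq_0_iff[OF b[OF that]] by simp
    qed
  qed
  have bdd: "bdd_above ((\<lambda>e. cmod (D e)) ` E)"
    by (rule bdd_aboveI2) (rule D_le)
  define s where "s = (SUP e\<in>E. cmod (D e))"
  have s: "cmod (D e) \<le> s" if "e \<in> E" for e
    unfolding s_def by (rule cSUP_upper[OF that bdd])
  have "0 < s" using s[OF e0] \<open>D e0 \<noteq> 0\<close> by (meson less_le_trans zero_less_norm_iff)
  then have "s / \<delta> < s" using \<delta> by (simp add: field_simps)
  then obtain e where e: "e \<in> E" "s / \<delta> < cmod (D e)"
    unfolding s_def using less_cSUP_iff[OF _ bdd, of "s / \<delta>"] e0 unfolding s_def by auto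
  have "0 < s / \<delta>" using \<open>0 < s\<close> \<delta> by simp
  then have De: "D e \<noteq> 0" using e(2) by auto
  have near_max: "cmod (D e') \<le> \<delta> * cmod (D e)" if "e' \<in> E" for e'
    using s[OF that] e(2) \<delta> by (simp add: field_simps)
  have eM: "e j \<in> ?M" and eN: "N (e j) \<le> 1" if "j < d" for j
    using e(1) that by (auto simp: E_def)
  define c where "c j l = family_cofactor d (a e) j l" for j l
  \<comment> \<open>The Cramer coordinate in cofactor form, which shows linearity in
    \<open>x\<close>; \<open>g0_D\<close> gives the quotient form, which yields the bound.\<close>
  define g0 where "g0 j x = (\<Sum>l<d. f l x * c j l) / D e" for j x
  have g0_D: "g0 j x = D (e(j := x)) / D e" if "j < d" for j x
  proof -
    have "a (e(j := x)) = (a e)(j := (\<lambda>l. f l x))" by (auto simp: a_def fun_eq_iff)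
    then show ?thesis by (simp add: D_def g0_def c_def family_det_update[OF that])
  qed
  have D_K: "D e' \<in> K" if "\<And>j. j < d \<Longrightarrow> e' j \<in> ?M" for e'
  proof -
    have "a e' j l \<in> K" if "j < d" "l < d" for j l
      unfolding a_def using linear_functional_K[OF fl[OF that(2)] MV] \<open>\<And>j. j < d \<Longrightarrow> e' j \<in> ?M\<close> that
      by simp
    then show ?thesis using family_det_Reals[of d "a e'"] field_cases by (auto simp: D_def)
  qed
  have g0_K: "g0 j x \<in> K" if "j < d" "x \<in> ?M" for j x
    unfolding g0_D[OF that(1)] divide_inverse using eM that
    by (intro K_closed D_K) auto
  have g0_add: "g0 j (x \<oplus> y) = g0 j x + g0 j y" if "x \<in> ?M" "y \<in> ?M" for j x y
  proof -
    have "f l (x \<oplus> y) = f l x + f l y" if "l < d" for l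
      by (rule linear_functional_add[OF fl[OF that] MV[OF \<open>x \<in> ?M\<close>] MV[OF \<open>y \<in> ?M\<close>]])
    then show ?thesis by (simp add: g0_def distrib_right sum.distrib add_divide_distrib)
  qed
  have g0_smult: "g0 j (t \<odot> x) = t * g0 j x" if "t \<in> K" "x \<in> ?M" for j t x
  proof -
    have "f l (t \<odot> x) = t * f l x" if "l < d" for l
      by (rule linear_functional_smult[OF fl[OF that] \<open>t \<in> K\<close> MV[OF \<open>x \<in> ?M\<close>]])
    then show ?thesis by (simp add: g0_def sum_distrib_left mult.assoc)
  qed
  have g0_le: "cmod (g0 j x) \<le> \<delta> * N x" if "j < d" "x \<in> ?M" for j x
  proof (cases "N x = 0")
    case True
    then have "x = \<zero>" using norm_eq_0_iff[OF MV[OF that(2)]] by simp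
    then have "g0 j x = 0" using linear_functional_zero[OF fl] by (simp add: g0_def)
    then show ?thesis using True by simp
  next
    case False
    let ?y = "complex_of_real (inverse (N x)) \<odot> x"
    have "e(j := ?y) \<in> E"
      using e(1) normalize[OF that(2)] by (simp add: E_def)
    from near_max[OF this] have "cmod (g0 j ?y) \<le> \<delta>"
      using De by (simp add: g0_D[OF that(1)] norm_divide divide_le_eq)
    then have "cmod (g0 j x) / N x \<le> \<delta>"
      unfolding g0_smult[OF of_real_K that(2)] using norm_nonneg[OF MV[OF that(2)]]
      by (simp add: norm_mult norm_inverse divide_inverse mult.commute)
    moreover have "0 < N x" using False norm_nonneg[OF MV[OF that(2)]] by simp
    ultimately show ?thesis by (simp add: divide_le_eq)
  qed
  have "\<exists>G. G \<in> dual_ball \<and> (\<forall>x\<in>?M. G x = g0 j x / \<delta>)" if j: "j < d" for j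
  proof -
    have zM: "\<zero> \<in> ?M"
      using linear_functional_zero linear_functional_zero[OF fl] by (simp add: biorthogonal_span_def)
    have dK: "inverse (complex_of_real \<delta>) \<in> K" by (intro K_closed of_real_K)
    show ?thesis
    proof (rule dual_ball_extension[of ?M "\<lambda>x. g0 j x / \<delta>"])
      show "g0 j x / \<delta> \<in> K" if "x \<in> ?M" for x
        unfolding divide_inverse by (intro K_closed(5) g0_K j that dK)
      show "cmod (g0 j x / \<delta>) \<le> N x" if "x \<in> ?M" for x
        using g0_le[OF j that] \<delta> by (simp add: norm_divide divide_le_eq mult.commute)
    qed (use MV zM biorthogonal_span_add[OF bf] biorthogonal_span_smult[OF bf] in
      \<open>auto simp: g0_add g0_smult add_divide_distrib\<close>)
  qed
  then have "\<forall>j\<in>{..<d}. \<exists>G. G \<in> dual_ball \<and> (\<forall>x\<in>?M. G x = g0 j x / \<delta>)" by simp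
  from bchoice[OF this] obtain g
    where "\<forall>j\<in>{..<d}. g j \<in> dual_ball \<and> (\<forall>x\<in>?M. g j x = g0 j x / \<delta>)" ..
  then have g: "g j \<in> dual_ball" "x \<in> ?M \<Longrightarrow> g j x = g0 j x / \<delta>" if "j < d" for j x
    using that by simp_all
  show ?thesis
  proof (rule that)
    show "e j \<in> carrier V" if "j < d" for j by (rule MV[OF eM[OF that]])
    fix x h assume x: "x \<in> ?M" and h: "linear_functional h"
    \<comment> \<open>Both factors are written in the reference basis. The sum over \<open>j\<close>
      then contracts cofactors with matrix entries and leaves only the terms with
      \<open>l = m\<close>, which is the expansion of \<open>h x\<close>.\<close>
    have "(\<Sum>j<d. g0 j x * h (e j))
        = (\<Sum>j<d. (\<Sum>l<d. f l x * c j l) / D e * (\<Sum>m<d. a e j m * h (b m)))"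
      using eM h by (intro sum.cong) (auto simp: g0_def a_def biorthogonal_span_def)
    also have "\<dots> = (\<Sum>j<d. \<Sum>l<d. \<Sum>m<d. f l x * h (b m) * (c j l * a e j m) / D e)"
      by (simp add: sum_distrib_left sum_distrib_right sum_divide_distrib mult_ac)
    also have "\<dots> = (\<Sum>l<d. \<Sum>j<d. \<Sum>m<d. f l x * h (b m) * (c j l * a e j m) / D e)"
      by (rule sum.swap)
    also have "\<dots> = (\<Sum>l<d. \<Sum>m<d. \<Sum>j<d. f l x * h (b m) * (c j l * a e j m) / D e)"
      by (intro sum.cong refl sum.swap)
    also have "\<dots> = (\<Sum>l<d. \<Sum>m<d. f l x * h (b m) * (\<Sum>j<d. c j l * a e j m) / D e)"
      by (simp add: sum_distrib_left sum_divide_distrib)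
    also have "\<dots> = (\<Sum>l<d. \<Sum>m<d. if l = m then f l x * h (b m) else 0)"
      using De by (intro sum.cong refl) (simp add: c_def sum_family_cofactor D_def)
    also have "\<dots> = (\<Sum>l<d. f l x * h (b l))" by simp
    also have "\<dots> = h x" using x h by (simp add: biorthogonal_span_def)
    finally have "h x = (\<Sum>j<d. g0 j x * h (e j))" by simp
    also have "\<dots> = (\<Sum>j<d. \<delta> * (g j x * h (e j)))"
      using g(2)[OF _ x] \<delta> by (intro sum.cong) auto
    finally show "h x = complex_of_real \<delta> * (\<Sum>j<d. g j x * h (e j))" by (simp add: sum_distrib_left)
  qed (use eN g(1) in auto)
qed

lemma near_auerbach:
  assumes "\<And>i. i < (k::nat) \<Longrightarrow> x i \<in> carrier V" and "1 < (\<delta>::real)"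
  obtains d e g where "d \<le> k" "\<And>j. j < d \<Longrightarrow> e j \<in> carrier V" "\<And>j. j < d \<Longrightarrow> N (e j) \<le> 1"
    "\<And>j. j < d \<Longrightarrow> g j \<in> dual_ball"
    "\<And>i h. i < k \<Longrightarrow> linear_functional h \<Longrightarrow> h (x i) = complex_of_real \<delta> * (\<Sum>j<d. g j (x i) * h (e j))"
proof -
  obtain d b f where *: "d \<le> k" "biorthogonal d b f" "\<And>i. i < k \<Longrightarrow> x i \<in> biorthogonal_span d b f"
    by (rule biorthogonal_exists[of k x, OF assms(1)]) (assumption, rule that)
  obtain e g where eg: "\<And>j. j < d \<Longrightarrow> e j \<in> carrier V" "\<And>j. j < d \<Longrightarrow> N (e j) \<le> 1"
    "\<And>j. j < d \<Longrightarrow> g j \<in> dual_ball"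
    "\<And>x h. x \<in> biorthogonal_span d b f \<Longrightarrow> linear_functional h \<Longrightarrow>
       h x = complex_of_real \<delta> * (\<Sum>j<d. g j x * h (e j))"
    by (rule near_auerbach_span[OF *(2) assms(2)]) (rule that)
  show ?thesis by (rule that[OF *(1) eg(1-3) eg(4)[OF *(3)]])
qed

section \<open>Functional norms and the induced metric\<close>

lemma functional_norm_bdd_above:
  assumes "bounded_functional K V N f"
  shows "bdd_above ((\<lambda>x. cmod (f x)) ` {x \<in> carrier V. N x \<le> 1})"
proof -
  obtain B where B: "\<forall>x\<in>carrier V. cmod (f x) \<le> B * N x"
    using assms unfolding bounded_functional_def by blast
  show ?thesis
  proof (rule bdd_aboveI2)
    fix x assume x: "x \<in> {x \<in> carrier V. N x \<le> 1}"
    then have "B * N x \<le> \<bar>B\<bar> * 1" using norm_nonneg[of x] by (intro mult_mono) auto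
    then show "cmod (f x) \<le> \<bar>B\<bar>" using B x by force
  qed
qed

lemma cmod_le_functional_norm:
  assumes f: "bounded_functional K V N f" and x: "x \<in> carrier V"
  shows "cmod (f x) \<le> functional_norm V N f * N x"
proof (cases "N x = 0")
  case True
  then show ?thesis using f x unfolding bounded_functional_def by fastforce
next
  case False
  then have Nx: "0 < N x" using norm_nonneg[OF x] by simp
  let ?y = "complex_of_real (inverse (N x)) \<odot> x"
  have y: "?y \<in> carrier V" by (rule smult_carrier[OF of_real_K x])
  have "N ?y \<le> 1" unfolding norm_smult[OF of_real_K x] using Nx by (simp add: norm_inverse)
  then have "cmod (f ?y) \<le> functional_norm V N f"
    unfolding functional_norm_def using y
    by (intro cSUP_upper[OF _ functional_norm_bdd_above[OF f]]) simp
  moreover have "f ?y = complex_of_real (inverse (N x)) * f x"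
    using f x unfolding bounded_functional_def by (intro linear_functional_smult of_real_K) auto
  ultimately have "inverse (N x) * cmod (f x) \<le> functional_norm V N f"
    using Nx by (simp add: norm_mult norm_inverse)
  then show ?thesis using Nx by (simp add: field_simps)
qed

text \<open>Both bounds are required to estimate a product of such norms by \<open>1\<close>; the
  zero vector keeps the supremum from being taken over an empty set.\<close>

lemma functional_norm_dual_ball:
  assumes "f \<in> dual_ball"
  shows "0 \<le> functional_norm V N f" "functional_norm V N f \<le> 1"
proof -
  have z: "\<zero> \<in> {x \<in> carrier V. N x \<le> 1}" by simp
  have "cmod (f \<zero>) \<le> functional_norm V N f"
    unfolding functional_norm_def
    by (intro cSUP_upper[OF z functional_norm_bdd_above] dual_ball_bounded_functional assms)
  then show "0 \<le> functional_norm V N f" using norm_ge_zero order_trans by blast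
  show "functional_norm V N f \<le> 1"
    unfolding functional_norm_def using z assms
    by (intro cSUP_least) (auto simp: dual_ball_def intro: order_trans)
qed

text \<open>For tensors, \<open>tensor_product_simps\<close> turns this form of the difference into
  \<open>w A + (-1) * z A\<close>, again a combination of elementary tensors.\<close>

lemma norm_dist_eq:
  assumes "x \<in> carrier V" "y \<in> carrier V"
  shows "norm_dist V N x y = N (x \<oplus> (-1) \<odot> y)"
  using assms by (simp add: norm_dist_def M.minus_eq smult_minus_1)

lemma Metric_space_norm_dist: "Metric_space (carrier V) (norm_dist V N)"
proof
  have m1: "-1 \<in> K" using K_closed by simp
  have mc: "(-1) \<odot> x \<in> carrier V" if "x \<in> carrier V" for x using that m1 by simp
  show "0 \<le> norm_dist V N x y" for x y
    using norm_nonneg by (simp add: norm_dist_def)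
  show "norm_dist V N x y = norm_dist V N y x" for x y
  proof (cases "x \<in> carrier V \<and> y \<in> carrier V")
    case True
    then have "y \<ominus> x = (-1) \<odot> (x \<ominus> y)"
      by (simp add: smult_minus_1 M.minus_eq M.minus_add M.a_comm)
    then show ?thesis using True norm_smult[OF m1, of "x \<ominus> y"] by (simp add: norm_dist_def)
  qed (auto simp: norm_dist_def)
  show "norm_dist V N x y = 0 \<longleftrightarrow> x = y" if "x \<in> carrier V" "y \<in> carrier V" for x y
  proof -
    have "(x \<ominus> y) \<oplus> y = x" using that by (simp add: M.minus_eq M.a_assoc M.l_neg)
    then have "x \<ominus> y = \<zero> \<longleftrightarrow> x = y" using that by (auto simp: M.minus_eq M.r_neg)
    then show ?thesis using that norm_eq_0_iff[of "x \<ominus> y"] by (simp add: norm_dist_def)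
  qed
  show "norm_dist V N x z \<le> norm_dist V N x y + norm_dist V N y z"
    if "x \<in> carrier V" "y \<in> carrier V" "z \<in> carrier V" for x y z
  proof -
    have "x \<ominus> z = (x \<ominus> y) \<oplus> (y \<ominus> z)"
      using that by (simp add: M.minus_eq M.a_assoc M.r_neg1 M.l_neg)
    then show ?thesis using norm_triangle[of "x \<ominus> y" "y \<ominus> z"] that by (simp add: norm_dist_def)
  qed
qed

end

section \<open>Tensors of bounded rank\<close>

lemma tuples_update:
  assumes "x \<in> tuples n X" "i \<in> {1..n}" "v \<in> carrier (X i)"
  shows "x(i := v) \<in> tuples n X"
  using assms by (auto simp: tuples_def PiE_iff extensional_def)

lemma tuples_carrier: "x \<in> tuples n X \<Longrightarrow> i \<in> {1..n} \<Longrightarrow> x i \<in> carrier (X i)"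
  by (auto simp: tuples_def)

lemma linear_map_multilinear_slot:
  assumes "multilinear_map K n X (scalars K) A" "x \<in> tuples n X" "i \<in> {1..n}"
  shows "linear_map K (X i) (scalars K) (\<lambda>v. A (x(i := v)))"
  using assms tuples_update[OF assms(2,3)]
  unfolding linear_map_def multilinear_map_def by blast

text \<open>A multilinear \<open>A\<close> is linear in slot \<open>a\<close>, so the assumed
  expansion applies to it; at every other \<open>A\<close> all elementary tensors vanish by
  definition.\<close>

lemma tensor_expand_slot:
  assumes a: "a \<in> {1..n}" and x: "\<And>i. i < k \<Longrightarrow> x i \<in> tuples n X"
    and expand: "\<And>i h. i < k \<Longrightarrow> linear_map K (X a) (scalars K) h \<Longrightarrow>
      h (x i a) = t * (\<Sum>l<d. g l (x i a) * h (e l))"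
  shows "(\<Sum>i<(k::nat). c i * elem_tensor K n X (x i) A)
    = (\<Sum>l<(d::nat). t * (\<Sum>i<k. (c i * g l (x i a)) * elem_tensor K n X ((x i)(a := e l)) A))"
proof (cases "multilinear_map K n X (scalars K) A")
  case True
  have "A (x i) = t * (\<Sum>l<d. g l (x i a) * A ((x i)(a := e l)))" if "i < k" for i
    using expand[OF that linear_map_multilinear_slot[OF True x[OF that] a]] by simp
  then have "(\<Sum>i<k. c i * elem_tensor K n X (x i) A)
      = (\<Sum>i<k. \<Sum>l<d. t * ((c i * g l (x i a)) * A ((x i)(a := e l))))"
    using True by (simp add: elem_tensor_def sum_distrib_left mult_ac)
  also have "\<dots> = (\<Sum>l<d. \<Sum>i<k. t * ((c i * g l (x i a)) * A ((x i)(a := e l))))"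
    by (rule sum.swap)
  finally show ?thesis using True by (simp add: elem_tensor_def sum_distrib_left)
qed (simp add: elem_tensor_def)

section \<open>Norm estimates from the values of product functionals\<close>

locale cross_normed_tensor_product =
  fixes K :: "complex set" and n :: nat and X :: "nat \<Rightarrow> (complex, 'a) module"
    and N :: "nat \<Rightarrow> 'a \<Rightarrow> real" and \<alpha> :: "(((nat \<Rightarrow> 'a) \<Rightarrow> complex) \<Rightarrow> complex) \<Rightarrow> real"
  assumes field_cases: "K = \<real> \<or> K = UNIV" and n_pos: "1 \<le> n"
    and factor: "i \<in> {1..n} \<Longrightarrow> normed_space K (X i) (N i)"
    and normed: "normed_space K (tensor_product K n X) \<alpha>"
    and cross: "x \<in> tuples n X \<Longrightarrow> \<alpha> (elem_tensor K n X x) \<le> (\<Prod>i\<in>{1..n}. N i (x i))"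
begin

abbreviation ball :: "nat \<Rightarrow> ('a \<Rightarrow> complex) set" where
  "ball j \<equiv> scalar_normed_space.dual_ball K (X j) (N j)"

lemma factor_scalar: "i \<in> {1..n} \<Longrightarrow> scalar_normed_space K (X i) (N i)"
  using factor field_cases
  by (simp add: scalar_normed_space_def scalar_normed_space_axioms_def)

sublocale T: scalar_normed_space K "tensor_product K n X" \<alpha>
  using normed field_cases
  by (simp add: scalar_normed_space_def scalar_normed_space_axioms_def)

lemma norm_sum_le:
  assumes "0 \<le> (t::real)" "\<And>l. l < (d::nat) \<Longrightarrow> z l \<in> carrier (tensor_product K n X)"
  shows "(\<lambda>A. \<Sum>l<d. complex_of_real t * z l A) \<in> carrier (tensor_product K n X) \<and>
    \<alpha> (\<lambda>A. \<Sum>l<d. complex_of_real t * z l A) \<le> t * (\<Sum>l<d. \<alpha> (z l))"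
  using assms(2)
proof (induction d)
  case 0
  then show ?case using T.M.zero_closed T.norm_zero by simp
next
  case (Suc d)
  let ?u = "\<lambda>A. \<Sum>l<d. complex_of_real t * z l A" and ?v = "\<lambda>A. complex_of_real t * z d A"
  have u: "?u \<in> carrier (tensor_product K n X)" "\<alpha> ?u \<le> t * (\<Sum>l<d. \<alpha> (z l))"
    using Suc by auto
  have zd: "z d \<in> carrier (tensor_product K n X)" using Suc.prems by simp
  have v: "?v \<in> carrier (tensor_product K n X)" "\<alpha> ?v = t * \<alpha> (z d)"
    using T.smult_carrier[OF T.of_real_K zd, of t] T.norm_smult[OF T.of_real_K zd, of t] assms(1)
    by simp_all
  show ?case
    using T.norm_triangle[OF u(1) v(1)] T.M.a_closed[OF u(1) v(1)] u(2) v(2)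
    by (simp add: distrib_left)
qed

text \<open>Summands that agree outside slot \<open>n\<close> add up to one elementary tensor, with
  the combined vector \<open>v\<close> in that slot. The cross property bounds it by
  \<open>N n v\<close>, and a norming functional of \<open>v\<close> is one of the tests bounded by
  \<open>B\<close>.\<close>

lemma norm_le_of_last_slot:
  assumes c: "\<And>i. i < k \<Longrightarrow> c i \<in> K" and x: "\<And>i. i < (k::nat) \<Longrightarrow> x i \<in> tuples n X"
    and same: "\<And>i i' j. i < k \<Longrightarrow> i' < k \<Longrightarrow> j \<in> {1..<n} \<Longrightarrow> x i j = x i' j"
    and unit: "\<And>i j. i < k \<Longrightarrow> j \<in> {1..<n} \<Longrightarrow> N j (x i j) \<le> 1"
    and B: "0 \<le> B" "\<And>f. f \<in> ball n \<Longrightarrow> cmod (\<Sum>i<k. c i * f (x i n)) \<le> B"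
  shows "\<alpha> (\<lambda>A. \<Sum>i<k. c i * elem_tensor K n X (x i) A) \<le> B"
\<comment> \<open>Without summands there is no tuple \<open>x 0\<close> to carry the common slots,
  and the tensor is zero.\<close>
proof (cases "k = 0")
  case True
  then show ?thesis using B(1) T.norm_zero by simp
next
  case False
  have n: "n \<in> {1..n}" using n_pos by simp
  interpret Xn: scalar_normed_space K "X n" "N n" by (rule factor_scalar[OF n])
  have xn: "x i n \<in> carrier (X n)" if "i < k" for i by (rule tuples_carrier[OF x[OF that] n])
  obtain v where v: "v \<in> carrier (X n)"
    "\<And>h. linear_map K (X n) (scalars K) h \<Longrightarrow> h v = (\<Sum>i<k. c i * h (x i n))"
    using Xn.linear_combination_exists[of k c "\<lambda>i. x i n", OF c xn] by auto
  let ?y = "(x 0)(n := v)"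
  have x0: "x 0 \<in> tuples n X" using x False by simp
  have y: "?y \<in> tuples n X" by (rule tuples_update[OF x0 n v(1)])
  have upd: "(x 0)(n := x i n) = x i" if "i < k" for i
  proof
    fix j
    show "((x 0)(n := x i n)) j = x i j"
      using same[of 0 i j] x0 x[OF that] that False
      by (cases "j \<in> {1..<n}") (auto simp: tuples_def PiE_iff extensional_def)
  qed
  have "(\<lambda>A. \<Sum>i<k. c i * elem_tensor K n X (x i) A) = elem_tensor K n X ?y"
  proof
    fix A
    show "(\<Sum>i<k. c i * elem_tensor K n X (x i) A) = elem_tensor K n X ?y A"
    proof (cases "multilinear_map K n X (scalars K) A")
      case True
      then show ?thesis
        using v(2)[OF linear_map_multilinear_slot[OF True x0 n]] upd by (simp add: elem_tensor_def)
    qed (simp add: elem_tensor_def)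
  qed
  then have "\<alpha> (\<lambda>A. \<Sum>i<k. c i * elem_tensor K n X (x i) A) \<le> (\<Prod>i\<in>{1..n}. N i (?y i))"
    using cross[OF y] by simp
  also have "\<dots> = N n v * (\<Prod>i\<in>{1..<n}. N i (x 0 i))"
  proof -
    have "{1..n} = insert n {1..<n}" using n_pos by auto
    then show ?thesis by simp
  qed
  also have "\<dots> \<le> N n v * 1"
  proof (rule mult_left_mono)
    show "(\<Prod>i\<in>{1..<n}. N i (x 0 i)) \<le> 1"
    proof (rule prod_le_1)
      fix j assume j: "j \<in> {1..<n}"
      then interpret Xj: scalar_normed_space K "X j" "N j" by (intro factor_scalar) auto
      show "0 \<le> N j (x 0 j) \<and> N j (x 0 j) \<le> 1"
        using unit[OF _ j, of 0] tuples_carrier[OF x0, of j] j False Xj.norm_nonneg by simp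
    qed
  qed (rule Xn.norm_nonneg[OF v(1)])
  also have "\<dots> \<le> B"
  proof -
    obtain F where F: "F \<in> ball n" "N n v \<le> cmod (F v)"
      by (rule Xn.norming_functional[OF v(1)]) (rule that)
    then have "F v = (\<Sum>i<k. c i * F (x i n))" using v(2) by (simp add: Xn.dual_ball_def)
    then show ?thesis using F(2) B(2)[OF F(1)] by simp
  qed
  finally show ?thesis .
qed

text \<open>
  Peeling off one slot \<open>a\<close> by a nearly Auerbach basis of the span of the \<open>a\<close>-th components costs a
  factor \<open>\<delta> r\<close> and keeps the functional bound \<open>B\<close>, because the coordinate functionals are
  themselves admissible test functionals.
\<close>

lemma norm_le_of_functional_bound:
  fixes c :: "nat \<Rightarrow> complex" and x :: "nat \<Rightarrow> nat \<Rightarrow> 'a"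
  assumes "finite I" "I \<subseteq> {1..<n}" and k: "k \<le> r" and \<delta>: "1 < \<delta>" and B: "0 \<le> B"
    and "\<And>i. i < k \<Longrightarrow> c i \<in> K" "\<And>i. i < k \<Longrightarrow> x i \<in> tuples n X"
    and "\<And>i i' j. i < k \<Longrightarrow> i' < k \<Longrightarrow> j \<in> {1..<n} - I \<Longrightarrow> x i j = x i' j"
    and "\<And>i j. i < k \<Longrightarrow> j \<in> {1..<n} - I \<Longrightarrow> N j (x i j) \<le> 1"
    and "\<And>f. (\<And>j. j \<in> insert n I \<Longrightarrow> f j \<in> ball j) \<Longrightarrow>
      cmod (\<Sum>i<k. c i * (\<Prod>j\<in>insert n I. f j (x i j))) \<le> B"
  shows "\<alpha> (\<lambda>A. \<Sum>i<k. c i * elem_tensor K n X (x i) A) \<le> (\<delta> * real r) ^ card I * B"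
  using assms(1,2,6-)
proof (induction I arbitrary: c x rule: finite_induct)
  case empty
  have "\<alpha> (\<lambda>A. \<Sum>i<k. c i * elem_tensor K n X (x i) A) \<le> B"
  proof (rule norm_le_of_last_slot[OF empty.prems(2,3) _ _ B])
    show "x i j = x i' j" if "i < k" "i' < k" "j \<in> {1..<n}" for i i' j
      using that by (intro empty.prems(4)) auto
    show "N j (x i j) \<le> 1" if "i < k" "j \<in> {1..<n}" for i j
      using that by (intro empty.prems(5)) auto
    show "cmod (\<Sum>i<k. c i * f (x i n)) \<le> B" if "f \<in> ball n" for f
      using empty.prems(6)[of "\<lambda>_. f"] that by simp
  qed
  then show ?case by simp
next
  case (insert a I)
  note c = insert.prems(2) and x = insert.prems(3)
  have a: "a \<in> {1..n}" "a \<noteq> n" and I: "I \<subseteq> {1..<n}" using insert.prems(1) by auto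
  interpret Xa: scalar_normed_space K "X a" "N a" by (rule factor_scalar[OF a(1)])
  have xa: "x i a \<in> carrier (X a)" if "i < k" for i by (rule tuples_carrier[OF x[OF that] a(1)])
  obtain d e g where d: "d \<le> k"
    and e: "\<And>l. l < d \<Longrightarrow> e l \<in> carrier (X a)" "\<And>l. l < d \<Longrightarrow> N a (e l) \<le> 1"
    and g: "\<And>l. l < d \<Longrightarrow> g l \<in> ball a"
    and expand: "\<And>i h. i < k \<Longrightarrow> linear_map K (X a) (scalars K) h \<Longrightarrow>
      h (x i a) = complex_of_real \<delta> * (\<Sum>l<d. g l (x i a) * h (e l))"
    by (rule Xa.near_auerbach[of k "\<lambda>i. x i a", OF xa \<delta>]) (assumption, rule that)
  \<comment> \<open>The part of the expansion with \<open>e l\<close> in slot \<open>a\<close>. The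
    coordinates move into the coefficients, so each part still has \<open>k\<close> summands and the
    induction hypothesis applies with the same \<open>r\<close> and \<open>B\<close>.\<close>
  define z where "z l = (\<lambda>A. \<Sum>i<k. (c i * g l (x i a)) * elem_tensor K n X ((x i)(a := e l)) A)" for l
  have gK: "c i * g l (x i a) \<in> K" if "l < d" "i < k" for l i
    using g[OF that(1)]
    by (intro Xa.K_closed(5) c that Xa.linear_functional_K xa) (simp add: Xa.dual_ball_def)
  have xe: "(x i)(a := e l) \<in> tuples n X" if "l < d" "i < k" for l i
    by (rule tuples_update[OF x[OF that(2)] a(1) e(1)[OF that(1)]])
  have z: "z l \<in> carrier (tensor_product K n X)" if "l < d" for l
    unfolding z_def using gK[OF that] xe[OF that] by (rule carrier_tensorI)
  have z_le: "\<alpha> (z l) \<le> (\<delta> * real r) ^ card I * B" if l: "l < d" for l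
    unfolding z_def
  proof (rule insert.IH[OF I])
    show "c i * g l (x i a) \<in> K" "(x i)(a := e l) \<in> tuples n X" if "i < k" for i
      using gK[OF l that] xe[OF l that] .
    show "((x i)(a := e l)) j = ((x i')(a := e l)) j"
      if "i < k" "i' < k" "j \<in> {1..<n} - I" for i i' j
      using insert.prems(4)[OF that(1,2), of j] that(3) by auto
    show "N j (((x i)(a := e l)) j) \<le> 1" if "i < k" "j \<in> {1..<n} - I" for i j
      using insert.prems(5)[OF that(1), of j] that(2) e(2)[OF l] by auto
    fix f assume f: "\<And>j. j \<in> insert n I \<Longrightarrow> f j \<in> ball j"
    have aI: "a \<notin> insert n I" using insert.hyps a by auto
    have fin: "finite (insert n I)" using insert.hyps by simp
    have ins: "insert n (insert a I) = insert a (insert n I)" by auto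
    \<comment> \<open>Putting \<open>g l\<close> in slot \<open>a\<close> of a test family for
      \<open>z l\<close> gives a test family for the original sum with the same value.\<close>
    have "(\<Prod>j\<in>insert n (insert a I). (f(a := g l)) j (x i j))
        = g l (x i a) * (\<Prod>j\<in>insert n I. f j (((x i)(a := e l)) j))" for i
    proof -
      have "(\<Prod>j\<in>insert n I. (f(a := g l)) j (x i j))
          = (\<Prod>j\<in>insert n I. f j (((x i)(a := e l)) j))"
        using aI by (intro prod.cong refl) auto
      then show ?thesis unfolding ins prod.insert[OF fin aI] by simp
    qed
    moreover have "cmod (\<Sum>i<k. c i * (\<Prod>j\<in>insert n (insert a I). (f(a := g l)) j (x i j))) \<le> B"
      using f g[OF l] by (intro insert.prems(6)) auto
    ultimately show "cmod (\<Sum>i<k. c i * g l (x i a) * (\<Prod>j\<in>insert n I. f j (((x i)(a := e l)) j))) \<le> B"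
      by (simp only: mult.assoc)
  qed
  have "(\<lambda>A. \<Sum>i<k. c i * elem_tensor K n X (x i) A) = (\<lambda>A. \<Sum>l<d. complex_of_real \<delta> * z l A)"
    unfolding z_def
    by (rule ext, rule tensor_expand_slot[where X = X and x = x and g = g and e = e, OF a(1) x expand])
  then have "\<alpha> (\<lambda>A. \<Sum>i<k. c i * elem_tensor K n X (x i) A) \<le> \<delta> * (\<Sum>l<d. \<alpha> (z l))"
    using norm_sum_le[of \<delta> d z] z \<delta> by simp
  also have "(\<Sum>l<d. \<alpha> (z l)) \<le> real d * ((\<delta> * real r) ^ card I * B)"
    using sum_bounded_above[of "{..<d}" "\<lambda>l. \<alpha> (z l)"] z_le by simp
  \<comment> \<open>The basis has \<open>d \<le> k \<le> r\<close> vectors.\<close>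
  also have "\<dots> \<le> real r * ((\<delta> * real r) ^ card I * B)"
    using d k B \<delta> by (intro mult_right_mono) auto
  finally show ?case using insert.hyps \<delta> by (simp add: mult_ac)
qed

text \<open>All \<open>n - 1\<close> slots before the last are peeled off, which gives the estimate
  with \<open>\<delta> m * real r\<close> for every \<open>m\<close>; the limit
  \<open>\<delta> m \<longlonglongrightarrow> 1\<close> removes the extra factor.\<close>

lemma norm_le_of_functional_bound_all:
  assumes k: "k \<le> r" and c: "\<And>i. i < k \<Longrightarrow> c i \<in> K" and x: "\<And>i. i < k \<Longrightarrow> x i \<in> tuples n X"
    and B: "0 \<le> B" "\<And>f. (\<And>j. j \<in> {1..n} \<Longrightarrow> f j \<in> ball j) \<Longrightarrow>
      cmod (\<Sum>i<k. c i * (\<Prod>j\<in>{1..n}. f j (x i j))) \<le> B"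
  shows "\<alpha> (\<lambda>A. \<Sum>i<k. c i * elem_tensor K n X (x i) A) \<le> real r ^ (n - 1) * B"
proof -
  have ins: "insert n {1..<n} = {1..n}" using n_pos by auto
  define \<delta> where "\<delta> m = 1 + inverse (real (Suc m))" for m
  have le: "\<alpha> (\<lambda>A. \<Sum>i<k. c i * elem_tensor K n X (x i) A) \<le> (\<delta> m * real r) ^ (n - 1) * B" for m
  proof -
    have "\<alpha> (\<lambda>A. \<Sum>i<k. c i * elem_tensor K n X (x i) A) \<le> (\<delta> m * real r) ^ card {1..<n} * B"
    proof (rule norm_le_of_functional_bound[OF finite_atLeastLessThan subset_refl k _ B(1) c x])
      show "1 < \<delta> m" by (simp add: \<delta>_def)
      show "cmod (\<Sum>i<k. c i * (\<Prod>j\<in>insert n {1..<n}. f j (x i j))) \<le> B"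
        if "\<And>j. j \<in> insert n {1..<n} \<Longrightarrow> f j \<in> ball j" for f
        using that unfolding ins by (rule B(2))
    qed simp_all
    then show ?thesis by simp
  qed
  have "\<delta> \<longlonglongrightarrow> 1"
    unfolding \<delta>_def using tendsto_add[OF tendsto_const LIMSEQ_inverse_real_of_nat, of 1] by simp
  then have "(\<lambda>m. (\<delta> m * real r) ^ (n - 1) * B) \<longlonglongrightarrow> (1 * real r) ^ (n - 1) * B"
    by (intro tendsto_mult tendsto_power tendsto_const)
  from LIMSEQ_le_const[OF this] le show ?thesis by simp
qed

end

section \<open>Rank representations and the comparison of two norms\<close>

text \<open>A tensor is given with scalar coefficients, whereas the rank counts bare elementary
  tensors. Absorbing the scalars shows that such a representation exists, so the least length is
  attained.\<close>

lemma tensor_rank_representation: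
  assumes K: "K = \<real> \<or> K = (UNIV :: complex set)" and n: "1 \<le> n"
    and X: "\<And>i. i \<in> {1..n} \<Longrightarrow> module (scalars K) (X i)"
    and z: "z \<in> rank_at_most K n X r"
  obtains k x where "k \<le> r" "\<And>i. i < k \<Longrightarrow> x i \<in> tuples n X"
    "z = (\<lambda>A. \<Sum>i<k. elem_tensor K n X (x i) A)"
proof -
  let ?P = "\<lambda>m. \<exists>x. (\<forall>i<m. x i \<in> tuples n X) \<and> z = (\<lambda>A. \<Sum>i<m. elem_tensor K n X (x i) A)"
  have "\<exists>m c x. (\<forall>i<(m::nat). c i \<in> K \<and> x i \<in> tuples n X) \<and>
      z = (\<lambda>A. \<Sum>i<m. c i * elem_tensor K n X (x i) A)"
    using z by (auto simp: rank_at_most_def tensor_product_def)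
  then obtain m :: nat and c x where m: "\<forall>i<m. c i \<in> K \<and> x i \<in> tuples n X"
    "z = (\<lambda>A. \<Sum>i<m. c i * elem_tensor K n X (x i) A)"
    by blast
  have 1: "1 \<in> {1..n}" using n by simp
  interpret X1: module "scalars K" "X 1" by (rule X[OF 1])
  \<comment> \<open>The coefficient moves into slot \<open>1\<close>, available because
    \<open>n\<close> is at least \<open>1\<close>.\<close>
  define y where "y i = (x i)(1 := c i \<odot>\<^bsub>X 1\<^esub> x i 1)" for i
  have y: "y i \<in> tuples n X" if "i < m" for i
    using m(1) that X1.smult_closed[of "c i" "x i 1"] tuples_carrier[OF _ 1, of "x i" X]
    unfolding y_def by (intro tuples_update[OF _ 1]) auto
  have "c i * elem_tensor K n X (x i) A = elem_tensor K n X (y i) A" if "i < m" for i A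
  proof (cases "multilinear_map K n X (scalars K) A")
    case True
    then have "linear_map K (X 1) (scalars K) (\<lambda>v. A ((x i)(1 := v)))"
      using m(1) that 1 by (intro linear_map_multilinear_slot) auto
    then show ?thesis
      using True m(1) that tuples_carrier[OF _ 1, of "x i" X]
      by (simp add: elem_tensor_def y_def linear_map_def)
  qed (simp add: elem_tensor_def)
  then have "?P m" using y m(2) by (intro exI[of _ y]) simp
  then have "?P (tensor_rank K n X z)" unfolding tensor_rank_def by (rule LeastI)
  moreover have "tensor_rank K n X z \<le> r" using z by (simp add: rank_at_most_def)
  ultimately show ?thesis using that by blast
qed

text \<open>The dual condition on \<open>\<beta>\<close> bounds the norm of the product functional
  by a product of norms, each at most \<open>1\<close>.\<close>

lemma reasonable_cross_norm_functional_le: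
  assumes K: "K = \<real> \<or> K = (UNIV :: complex set)"
    and X: "\<And>i. i \<in> {1..n} \<Longrightarrow> scalar_normed_space K (X i) (N i)"
    and \<beta>: "reasonable_cross_norm K n X N \<beta>" and z: "z \<in> carrier (tensor_product K n X)"
    and f: "\<And>i. i \<in> {1..n} \<Longrightarrow> f i \<in> scalar_normed_space.dual_ball K (X i) (N i)"
  shows "cmod (tensor_functional n f z) \<le> \<beta> z"
proof -
  interpret T: scalar_normed_space K "tensor_product K n X" \<beta>
    using \<beta> K
    by (simp add: reasonable_cross_norm_def scalar_normed_space_def scalar_normed_space_axioms_def)
  have bf: "bounded_functional K (X i) (N i) (f i)" if "i \<in> {1..n}" for i
    using scalar_normed_space.dual_ball_bounded_functional[OF X f] that by blast
  have fn: "0 \<le> functional_norm (X i) (N i) (f i) \<and> functional_norm (X i) (N i) (f i) \<le> 1"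
    if "i \<in> {1..n}" for i
    using scalar_normed_space.functional_norm_dual_ball[OF X f] that by blast
  have tf: "bounded_functional K (tensor_product K n X) \<beta> (tensor_functional n f)"
    "functional_norm (tensor_product K n X) \<beta> (tensor_functional n f)
      \<le> (\<Prod>i\<in>{1..n}. functional_norm (X i) (N i) (f i))"
    using \<beta> bf unfolding reasonable_cross_norm_def by blast+
  have "(\<Prod>i\<in>{1..n}. functional_norm (X i) (N i) (f i)) \<le> 1"
    using fn by (intro prod_le_1)
  with tf(2) have "functional_norm (tensor_product K n X) \<beta> (tensor_functional n f) * \<beta> z \<le> 1 * \<beta> z"
    using T.norm_nonneg[OF z] by (intro mult_right_mono) auto
  then show ?thesis using T.cmod_le_functional_norm[OF tf(1) z] by simp
qed

text \<open>The values of product functionals link the two norms: \<open>\<beta>\<close> bounds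
  them, so \<open>\<beta> z\<close> serves as the constant \<open>B\<close> in the estimate for
  \<open>\<alpha>\<close>. The coefficients \<open>c\<close> allow differences of tensors as
  well.\<close>

lemma reasonable_cross_norm_rank_le:
  assumes K: "K = \<real> \<or> K = (UNIV :: complex set)" and n: "1 \<le> n"
    and X: "\<And>i. i \<in> {1..n} \<Longrightarrow> normed_space K (X i) (N i)"
    and \<alpha>: "reasonable_cross_norm K n X N \<alpha>" and \<beta>: "reasonable_cross_norm K n X N \<beta>"
    and k: "k \<le> r" and c: "\<And>i. i < k \<Longrightarrow> c i \<in> K" and x: "\<And>i. i < k \<Longrightarrow> x i \<in> tuples n X"
    and z: "z = (\<lambda>A. \<Sum>i<k. c i * elem_tensor K n X (x i) A)"
  shows "\<alpha> z \<le> real r ^ (n - 1) * \<beta> z"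
proof -
  interpret a: cross_normed_tensor_product K n X N \<alpha>
    by (rule cross_normed_tensor_product.intro)
      (use K n X \<alpha> in \<open>simp_all add: reasonable_cross_norm_def\<close>)
  interpret b: cross_normed_tensor_product K n X N \<beta>
    by (rule cross_normed_tensor_product.intro)
      (use K n X \<beta> in \<open>simp_all add: reasonable_cross_norm_def\<close>)
  have zc: "z \<in> carrier (tensor_product K n X)"
    unfolding z using c x by (rule carrier_tensorI)
  show ?thesis
    unfolding z
  proof (rule a.norm_le_of_functional_bound_all[OF k c x])
    show "0 \<le> \<beta> (\<lambda>A. \<Sum>i<k. c i * elem_tensor K n X (x i) A)"
      using b.T.norm_nonneg[OF zc] z by simp
    fix f assume f: "\<And>j. j \<in> {1..n} \<Longrightarrow> f j \<in> a.ball j"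
    have fl: "linear_map K (X j) (scalars K) (f j)" if "j \<in> {1..n}" for j
      using f[OF that] by (simp add: scalar_normed_space.dual_ball_def[OF a.factor_scalar[OF that]])
    have "tensor_functional n f z = (\<Sum>i<k. c i * (\<Prod>j\<in>{1..n}. f j (x i j)))"
      using multilinear_prod[where X = X and f = f and n = n, OF K fl]
      by (simp add: tensor_functional_def z elem_tensor_def)
    then show "cmod (\<Sum>i<k. c i * (\<Prod>j\<in>{1..n}. f j (x i j)))
        \<le> \<beta> (\<lambda>A. \<Sum>i<k. c i * elem_tensor K n X (x i) A)"
      using reasonable_cross_norm_functional_le[OF K a.factor_scalar \<beta> zc f] z by simp
  qed
qed

theorem theorem2p1:
  fixes K :: "complex set"
    and n r :: nat
    and X :: "nat \<Rightarrow> (complex, 'a) module"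
    and N :: "nat \<Rightarrow> 'a \<Rightarrow> real"
    and \<alpha> \<beta> :: "(((nat \<Rightarrow> 'a) \<Rightarrow> complex) \<Rightarrow> complex) \<Rightarrow> real"
  assumes "K = \<real> \<or> K = UNIV"
    and "n \<ge> 1"
    and "r \<ge> 1"
    and "\<And>i. i \<in> {1..n} \<Longrightarrow> banach_space K (X i) (N i)"
    and "reasonable_cross_norm K n X N \<alpha>"
    and "reasonable_cross_norm K n X N \<beta>"
  shows "let S = rank_at_most K n X r;
             d\<^sub>\<alpha> = norm_dist (tensor_product K n X) \<alpha>;
             d\<^sub>\<beta> = norm_dist (tensor_product K n X) \<beta>
         in Metric_space S d\<^sub>\<alpha> \<and> Metric_space S d\<^sub>\<beta> \<and>
            Lipschitz_continuous_map (metric (S, d\<^sub>\<alpha>)) (metric (S, d\<^sub>\<beta>)) id \<and>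
            Lipschitz_continuous_map (metric (S, d\<^sub>\<beta>)) (metric (S, d\<^sub>\<alpha>)) id \<and>
            (\<forall>w\<in>S. \<forall>z\<in>S. d\<^sub>\<alpha> w z \<le> (2 * real r) ^ (n - 1) * d\<^sub>\<beta> w z) \<and>
            (\<forall>z\<in>S. \<alpha> z \<le> real r ^ (n - 1) * \<beta> z)"
proof -
  let ?T = "tensor_product K n X" and ?S = "rank_at_most K n X r"
  have normed: "normed_space K (X i) (N i)" if "i \<in> {1..n}" for i
    using assms(4)[OF that] by (simp add: banach_space_def)
  have mod: "module (scalars K) (X i)" if "i \<in> {1..n}" for i
    using normed[OF that] by (simp add: normed_space_def)
  have scalar: "scalar_normed_space K ?T \<gamma>" if "reasonable_cross_norm K n X N \<gamma>" for \<gamma>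
    using that assms(1)
    by (simp add: reasonable_cross_norm_def scalar_normed_space_def scalar_normed_space_axioms_def)
  have S: "?S \<subseteq> carrier ?T" by (auto simp: rank_at_most_def)
  have metric: "Metric_space ?S (norm_dist ?T \<gamma>)" if "reasonable_cross_norm K n X N \<gamma>" for \<gamma>
    by (rule Metric_space.subspace[OF scalar_normed_space.Metric_space_norm_dist[OF scalar[OF that]] S])
  note rep = tensor_rank_representation[OF assms(1,2) mod]
  have dist: "norm_dist ?T \<gamma> w z \<le> (2 * real r) ^ (n - 1) * norm_dist ?T \<gamma>' w z"
    if \<gamma>: "reasonable_cross_norm K n X N \<gamma>" "reasonable_cross_norm K n X N \<gamma>'"
      and wz: "w \<in> ?S" "z \<in> ?S" for \<gamma> \<gamma>' w z
  proof -
    obtain k x where x: "k \<le> r" "\<And>i. i < k \<Longrightarrow> x i \<in> tuples n X"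
      "w = (\<lambda>A. \<Sum>i<k. elem_tensor K n X (x i) A)"
      using rep[OF _ wz(1)] by blast
    obtain l y where y: "l \<le> r" "\<And>i. i < l \<Longrightarrow> y i \<in> tuples n X"
      "z = (\<lambda>A. \<Sum>i<l. elem_tensor K n X (y i) A)"
      using rep[OF _ wz(2)] by blast
    \<comment> \<open>The summands of \<open>w\<close> and \<open>z\<close> are concatenated, with
      coefficient \<open>-1\<close> on those of \<open>z\<close>. At most \<open>2 * r\<close>
      summands result, whence the constant for the distances.\<close>
    define c :: "nat \<Rightarrow> complex" where "c i = (if i < k then 1 else -1)" for i
    define u where "u i = (if i < k then x i else y (i - k))" for i
    have split: "(\<Sum>i<k + l. g i) = (\<Sum>i<k. g i) + (\<Sum>i<l. g (k + i))" for g :: "nat \<Rightarrow> complex"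
      by (induction l) (simp_all add: add.assoc)
    have diff: "(\<lambda>A. w A + (-1) * z A) = (\<lambda>A. \<Sum>i<k + l. c i * elem_tensor K n X (u i) A)"
      unfolding split by (simp add: x(3) y(3) c_def u_def sum_negf)
    have "\<gamma> (\<lambda>A. w A + (-1) * z A) \<le> real (2 * r) ^ (n - 1) * \<gamma>' (\<lambda>A. w A + (-1) * z A)"
    proof (rule reasonable_cross_norm_rank_le[OF assms(1,2) normed \<gamma> _ _ _ diff])
      show "k + l \<le> 2 * r" using x(1) y(1) by simp
      show "c i \<in> K" for i using scalars_closed[OF assms(1)] by (simp add: c_def)
      show "u i \<in> tuples n X" if "i < k + l" for i using that x(2) y(2) by (simp add: u_def)
    qed
    moreover have "w \<in> carrier ?T" "z \<in> carrier ?T" using wz S by auto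
    ultimately show ?thesis
      using scalar_normed_space.norm_dist_eq[OF scalar[OF \<gamma>(1)], of w z]
        scalar_normed_space.norm_dist_eq[OF scalar[OF \<gamma>(2)], of w z] by simp
  qed
  have norm: "\<alpha> z \<le> real r ^ (n - 1) * \<beta> z" if z: "z \<in> ?S" for z
  proof -
    obtain k x where x: "k \<le> r" "\<And>i. i < k \<Longrightarrow> x i \<in> tuples n X"
      "z = (\<lambda>A. \<Sum>i<k. elem_tensor K n X (x i) A)"
      using rep[OF _ z] by blast
    show ?thesis
      by (rule reasonable_cross_norm_rank_le[OF assms(1,2) normed assms(5,6) x(1), of "\<lambda>_. 1" x])
        (use x scalars_closed[OF assms(1)] in simp_all)
  qed
  \<comment> \<open>The condition bounds the distance in the target metric by that in the source, so
    \<open>dist\<close> is used with the two norms exchanged.\<close>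
  have Lipschitz: "Lipschitz_continuous_map (metric (?S, norm_dist ?T \<gamma>)) (metric (?S, norm_dist ?T \<gamma>')) id"
    if \<gamma>: "reasonable_cross_norm K n X N \<gamma>" "reasonable_cross_norm K n X N \<gamma>'" for \<gamma> \<gamma>'
    unfolding Lipschitz_continuous_map_def
      Metric_space.mspace_metric[OF metric[OF \<gamma>(1)]] Metric_space.mdist_metric[OF metric[OF \<gamma>(1)]]
      Metric_space.mspace_metric[OF metric[OF \<gamma>(2)]] Metric_space.mdist_metric[OF metric[OF \<gamma>(2)]]
    using dist[OF \<gamma>(2,1)] by auto
  show ?thesis
    unfolding Let_def
    using metric[OF assms(5)] metric[OF assms(6)] Lipschitz[OF assms(5,6)] Lipschitz[OF assms(6,5)]
      dist[OF assms(5,6)] norm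
    by blast
qed

end
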